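(* Assume (A1)–(A5) and let $(y_n)$ be the iterates with adapted step sizes $y_{n+1}=y_n+\frac{a(n)}{g(y_n)}[h(y_n)+M_{n+1}]$ (all as specified in the context). Then almost surely $y_n\to\bar H^M$ as $n\to\infty$. In particular, $\sup_n\|y_n\|<\infty$ almost surely.
   Context: Setting. $h:\mathbb R^d\to\mathbb R^d$, $(a(n))_{n\ge0}$ are positive deterministic step sizes, $W:\mathbb R^d\to[0,\infty)$ is continuously differentiable, and $y_0$ is an $\mathbb R^d$-valued random vector. $(M_n)_{n\ge1}$ are $\mathbb R^d$-valued random vectors, and $\mathcal F_n=\sigma(y_0,M_1,\dots,M_n)$. (A1) $h$ is locally Lipschitz. (A2) (i) $\sum_n a(n)=\infty$; (ii) $\sum_n a(n)^2<\infty$. (A3) (i) $E[M_{n+1}\mid\mathcal F_n]=0$ a.s. for all $n\ge0$; (ii) each $M_n$ is square integrable and there is a locally bounded measurable $f:\mathbb R^d\to[0,\infty)$ with $E[\|M_{n+1}\|^2\mid\mathcal F_n]\le f(y_n)$ a.s. for all $n\ge0$. (A4) (i) $W\ge0$ and $W(x)\to\infty$ as $\|x\|\to\infty$; (ii) $M$ is a positive integer such that $h(x)\cdot\nabla W(x)<0$ whenever $W(x)\ge M$. (A5) $W$ is twice continuously differentiable and all its second order derivatives are bounded in absolute value by a constant. For real $r$, $H^r:=\{x:W(x)<r\}$ and $\bar H^r$ is its closure; $H^\infty=\bar H^\infty=\mathbb R^d$. Choice of $N$ and $g$. $N$ is a positive integer or $\infty$, with $M<N\le\infty$, such that there is a finite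 constant $c_N>\max\left(1,\sup_{y\in\bar H^N\setminus H^M}\frac{\|h(y)\|^2+f(y)}{W(y)}\right)$ (this always holds for finite $N$). $g:\mathbb R^d\to\mathbb R$ is a locally bounded measurable function with $g(y)\ge\max\left(1,\ \mathbb I\{W(y)>N\}\sqrt{\frac{\|h(y)\|^2+f(y)}{W(y)}}\right)$ for all $y$ (the second term being $0$ when $W(y)\le N$). Iterates: $y_{n+1}=y_n+a^\omega(n)[h(y_n)+M_{n+1}]$ for $n\ge0$, where $a^\omega(n):=a(n)/g(y_n)$. Convergence $y_n\to\bar H^M$ means that the distance from $y_n$ to the set $\bar H^M$ tends to $0$. *)

theory Defs
  imports "HOL-Probability.Probability"
begin

definition grad :: "('a::euclidean_space \<Rightarrow> real) \<Rightarrow> 'a \<Rightarrow> 'a" where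
  "grad F x = (THE D. GDERIV F x :> D)"

definition C1 :: "('a::euclidean_space \<Rightarrow> real) \<Rightarrow> bool" where
  "C1 F \<longleftrightarrow> (\<forall>x. F differentiable (at x)) \<and> continuous_on UNIV (grad F)"

definition pderiv2 :: "(real ^ 'd \<Rightarrow> real) \<Rightarrow> 'd \<Rightarrow> 'd \<Rightarrow> real ^ 'd \<Rightarrow> real" where
  "pderiv2 F i j x = grad (\<lambda>z. grad F z $ i) x $ j"

definition C2 :: "(real ^ 'd \<Rightarrow> real) \<Rightarrow> bool" where
  "C2 F \<longleftrightarrow> C1 F \<and> (\<forall>i. C1 (\<lambda>x. grad F x $ i))"

definition locally_bounded :: "('a::metric_space \<Rightarrow> real) \<Rightarrow> bool" where
  "locally_bounded F \<longleftrightarrow> (\<forall>x. \<exists>r>0. bounded (F ` ball x r))"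

(* The level is an extended real, so that the sublevel set at infinity is the whole space. *)
definition sublevel :: "('a \<Rightarrow> real) \<Rightarrow> ereal \<Rightarrow> 'a set" where
  "sublevel W r = {x. ereal (W x) < r}"

(* The sigma-algebra generated by Y and Z 1, ..., Z n; the value Z 0 is not used. *)
definition history ::
  "'w measure \<Rightarrow> ('w \<Rightarrow> 'a::topological_space) \<Rightarrow> (nat \<Rightarrow> 'w \<Rightarrow> 'a) \<Rightarrow> nat \<Rightarrow> 'w measure" where
  "history P Y Z n =
     sigma (space P)
       (sets (vimage_algebra (space P) Y borel) \<union>
        (\<Union>i\<in>{1..n}. sets (vimage_algebra (space P) (Z i) borel)))"

(* Coordinatewise, since real_cond_exp is only available for real-valued functions. *)
definition vec_cond_exp ::
  "'w measure \<Rightarrow> 'w measure \<Rightarrow> ('w \<Rightarrow> real ^ 'd) \<Rightarrow> 'w \<Rightarrow> real ^ 'd" where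
  "vec_cond_exp P F X \<omega> = (\<chi> i. real_cond_exp P F (\<lambda>w. X w $ i) \<omega>)"

lemma grad_eq:
  assumes "GDERIV F x :> D"
  shows "grad F x = D"
proof -
  have "E = D" if "GDERIV F x :> E" for E
  proof -
    have "(\<lambda>h. inner h E) = (\<lambda>h. inner h D)"
      using that assms unfolding gderiv_def by (rule has_derivative_unique)
    then show ?thesis
      by (simp add: fun_eq_iff vector_eq_ldot)
  qed
  then show ?thesis
    unfolding grad_def using assms by (rule the_equality[rotated])
qed

lemma differentiable_GDERIV_grad:
  fixes F :: "'a::euclidean_space \<Rightarrow> real"
  assumes "F differentiable (at x)"
  shows "GDERIV F x :> grad F x"
proof -
  obtain L where L: "(F has_derivative L) (at x)"
    using assms by (auto simp: differentiable_def)
  then have lin: "linear L"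
    by (rule has_derivative_linear)
  have "L = (\<lambda>h. inner h (adjoint L 1))"
    by (rule ext) (simp add: adjoint_works[OF lin])
  then have "GDERIV F x :> adjoint L 1"
    using L unfolding gderiv_def by simp
  then show ?thesis
    using grad_eq[OF \<open>GDERIV F x :> adjoint L 1\<close>] by simp
qed

lemma subalgebra_history:
  assumes "Y \<in> borel_measurable P" "\<And>n. n \<ge> 1 \<Longrightarrow> Z n \<in> borel_measurable P"
  shows "subalgebra P (history P Y Z n)"
proof -
  have *: "sets (vimage_algebra (space P) V borel) \<subseteq> sets P"
    if "V \<in> borel_measurable P" for V :: "'a \<Rightarrow> 'b"
    using that by (simp add: sets.sigma_sets_subset measurable_iff_sets)
  let ?G = "sets (vimage_algebra (space P) Y borel) \<union>
      (\<Union>i\<in>{1..n}. sets (vimage_algebra (space P) (Z i) borel))"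
  have sub: "?G \<subseteq> sets P"
    using *[OF assms(1)] *[OF assms(2)] by (intro Un_least UN_least) simp_all
  then have "?G \<subseteq> Pow (space P)"
    by (rule subset_trans[OF _ sets.space_closed])
  then show ?thesis
    unfolding subalgebra_def history_def
    using sets.sigma_sets_subset[OF sub] by (simp add: space_measure_of_conv)
qed

end

theory Submission
  imports Defs
begin

text \<open>Compose \<open>W\<close> with a Huber function that vanishes below the level \<open>M\<close>: the resulting \<open>V\<close> has a
  quadratic remainder, and its drift along \<open>h\<close> is nonpositive everywhere. The choice of \<open>g\<close> bounds
  the second order term by a multiple of \<open>a(n)\<^sup>2 (V + 1)\<close>, so \<open>V(y\<^sub>n) + 1\<close>, divided by the product
  of the factors \<open>1 + c a(k)\<^sup>2\<close>, is a nonnegative supermartingale, and Ville's inequality shows that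
  \<open>W(y\<^sub>n)\<close> is almost surely bounded. On \<open>{W \<le> R}\<close> the noise has summable conditional variances, hence
  the noise series converges almost surely. Shifting \<open>y\<^sub>n\<close> by its tail leaves a deterministic
  recursion along which \<open>W\<close> decreases above the level \<open>M\<close> by a multiple of the step sizes,
  whose sum diverges.\<close>

section \<open>Functions with Lipschitz gradient\<close>

text \<open>Two obstacles shape the argument. The drift condition says nothing below level
  \<open>M\<close>, so \<open>W\<close> has to be flattened there; but \<open>grad W\<close> may be
  unbounded, and a general smooth function of \<open>W\<close> would produce a second order term
  with the square of the gradient. The Huber function has slope exactly 1 from 1 on, so its
  curvature is confined to a compact sublevel set of \<open>W\<close>, where the gradient is
  bounded. The other obstacle is integrability: \<open>y 0\<close> is not assumed to have moments,
  and \<open>h (y n)\<close> and \<open>f (y n)\<close> need not be integrable. Conditional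
  expectations therefore enter only through integrals against bounded weights measurable at time
  \<open>n\<close>, the one-step estimate for \<open>V\<close> is restricted to events on which
  \<open>y n\<close> lies in a compact set, and the maximal inequality is arranged to ask for no
  more than that.\<close>

lemma locally_bounded_compact:
  assumes F: "locally_bounded F" and K: "compact K"
  obtains B where "\<And>x. x \<in> K \<Longrightarrow> \<bar>F x\<bar> \<le> B"
proof -
  have "\<exists>r. \<forall>x. r x > 0 \<and> bounded (F ` ball x (r x))"
    using F unfolding locally_bounded_def by metis
  then obtain r where r: "\<And>x. r x > 0" "\<And>x. bounded (F ` ball x (r x))"
    by blast
  obtain C where C: "C \<subseteq> K" "finite C" "K \<subseteq> (\<Union>x\<in>C. ball x (r x))"
    by (rule compactE_image[OF K, of K "\<lambda>x. ball x (r x)"]) (use r in auto)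
  have "bounded (\<Union>x\<in>C. F ` ball x (r x))"
    using C(2) r(2) by blast
  then have "bounded (F ` K)"
    by (rule bounded_subset) (use C(3) in blast)
  then show thesis
    using that unfolding bounded_iff by auto
qed

lemma grad_bound_imp_lipschitz:
  fixes G :: "real ^ 'd \<Rightarrow> real"
  assumes diff: "\<And>x. G differentiable (at x)" and bd: "\<And>x. norm (grad G x) \<le> B"
  shows "\<bar>G x - G z\<bar> \<le> B * norm (x - z)"
proof -
  have der: "(G has_derivative (\<lambda>u. u \<bullet> grad G x)) (at x within UNIV)" for x
    using differentiable_GDERIV_grad[OF diff] by (simp add: gderiv_def)
  have "onorm (\<lambda>u. u \<bullet> grad G x) \<le> B" for x
  proof (rule onorm_bound)
    show "0 \<le> B" using bd[of 0] norm_ge_zero order_trans by blast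
    show "norm (u \<bullet> grad G x) \<le> B * norm u" for u
      using Cauchy_Schwarz_ineq2[of u "grad G x"] mult_left_mono[OF bd[of x], of "norm u"]
      by (simp add: mult.commute)
  qed
  then show ?thesis
    using differentiable_bound[OF convex_UNIV der, of B x z] by simp
qed

lemma C2_lipschitz_grad:
  fixes W :: "real ^ 'd \<Rightarrow> real"
  assumes "C2 W" and K: "\<And>i j x. \<bar>pderiv2 W i j x\<bar> \<le> K"
  obtains L where "L > 0" "\<And>x z. norm (grad W x - grad W z) \<le> L * norm (x - z)"
proof -
  let ?d = "real CARD('d)"
  have K0: "K \<ge> 0" using K[of undefined undefined 0] by linarith
  have comp: "\<bar>grad W x $ i - grad W z $ i\<bar> \<le> ?d * K * norm (x - z)" for i x z
  proof (rule grad_bound_imp_lipschitz)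
    show "(\<lambda>x. grad W x $ i) differentiable at x" for x
      using assms(1) unfolding C2_def C1_def by blast
    show "norm (grad (\<lambda>x. grad W x $ i) x) \<le> ?d * K" for x
    proof -
      have "norm (grad (\<lambda>x. grad W x $ i) x) \<le> (\<Sum>j\<in>UNIV. \<bar>grad (\<lambda>x. grad W x $ i) x $ j\<bar>)"
        by (rule norm_le_l1_cart)
      also have "\<dots> \<le> (\<Sum>j\<in>(UNIV::'d set). K)"
        using K by (intro sum_mono) (simp add: pderiv2_def)
      finally show ?thesis by simp
    qed
  qed
  \<comment> \<open>One factor \<open>?d\<close> comes from bounding the gradient of a component by
    its entries, the other from summing over the components. The added 1 keeps the constant positive
    when \<open>K\<close> is 0.\<close>
  have "norm (grad W x - grad W z) \<le> (?d * (?d * K) + 1) * norm (x - z)" for x z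
  proof -
    have "norm (grad W x - grad W z) \<le> (\<Sum>i\<in>UNIV. \<bar>(grad W x - grad W z) $ i\<bar>)"
      by (rule norm_le_l1_cart)
    also have "\<dots> \<le> (\<Sum>i\<in>(UNIV::'d set). ?d * K * norm (x - z))"
      using comp by (intro sum_mono) simp
    also have "\<dots> = ?d * (?d * K) * norm (x - z)" by simp
    also have "\<dots> \<le> (?d * (?d * K) + 1) * norm (x - z)"
      by (intro mult_right_mono) auto
    finally show ?thesis .
  qed
  moreover have "?d * (?d * K) + 1 > 0"
    using K0 by (intro add_nonneg_pos mult_nonneg_nonneg) auto
  ultimately show thesis using that by blast
qed

text \<open>Mean value theorem on the segment from \<open>x\<close> to \<open>x + u\<close>. The
  constant is \<open>L\<close> instead of \<open>L / 2\<close>, which is harmless since only the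
  order matters later. The two-sided form also allows expanding backwards from the endpoint.\<close>

lemma lipschitz_grad_remainder:
  fixes W :: "'a::euclidean_space \<Rightarrow> real"
  assumes diff: "\<And>x. W differentiable (at x)"
    and lip: "\<And>x z. norm (grad W x - grad W z) \<le> L * norm (x - z)"
  shows "\<bar>W (x + u) - W x - grad W x \<bullet> u\<bar> \<le> L * (norm u)\<^sup>2"
proof -
  let ?p = "\<lambda>t. W (x + t *\<^sub>R u)"
  have "(?p has_derivative (\<lambda>s. s * (u \<bullet> grad W (x + t *\<^sub>R u)))) (at t)" for t
  proof -
    have W: "(W has_derivative (\<lambda>v. v \<bullet> grad W (x + t *\<^sub>R u))) (at (x + t *\<^sub>R u))"
      using differentiable_GDERIV_grad[OF diff] by (simp add: gderiv_def)
    have "((\<lambda>t. x + t *\<^sub>R u) has_derivative (\<lambda>s. s *\<^sub>R u)) (at t)"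
      by (auto intro!: derivative_eq_intros)
    from has_derivative_compose[OF this W] show ?thesis by simp
  qed
  then have "\<exists>t>0. t < 1 \<and> ?p 1 - ?p 0 = (1 - 0) * (u \<bullet> grad W (x + t *\<^sub>R u))"
    by (intro MVT2) (simp_all add: has_field_derivative_def mult_commute_abs)
  then obtain t where t: "0 < t" "t < 1" "W (x + u) - W x = u \<bullet> grad W (x + t *\<^sub>R u)"
    by auto
  have "\<bar>W (x + u) - W x - grad W x \<bullet> u\<bar> = \<bar>u \<bullet> (grad W (x + t *\<^sub>R u) - grad W x)\<bar>"
    using t(3) by (simp add: inner_diff_right inner_commute)
  also have "\<dots> \<le> norm u * norm (grad W (x + t *\<^sub>R u) - grad W x)"
    by (rule Cauchy_Schwarz_ineq2)
  also have "\<dots> \<le> norm u * (L * norm (t *\<^sub>R u))"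
    using lip[of "x + t *\<^sub>R u" x] by (intro mult_left_mono) auto
  also have "\<dots> = t * (L * (norm u)\<^sup>2)"
    using t by (simp add: power2_eq_square)
  also have "\<dots> \<le> 1 * (L * (norm u)\<^sup>2)"
  proof -
    have "norm (grad W u - grad W 0) \<le> L * norm (u - 0)" by (rule lip)
    then have "0 \<le> L * norm u" by (smt (verit) norm_ge_zero diff_zero)
    then have "0 \<le> L * (norm u)\<^sup>2"
      by (metis mult.assoc mult_nonneg_nonneg norm_ge_zero power2_eq_square)
    then show ?thesis using t by (intro mult_right_mono) auto
  qed
  finally show ?thesis by simp
qed

lemma compact_sublevel_coercive:
  fixes W :: "'a::euclidean_space \<Rightarrow> real"
  assumes "continuous_on UNIV W" and "filterlim W at_top at_infinity"
  shows "compact {x. W x \<le> r}"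
proof -
  have "eventually (\<lambda>x. W x > r) at_infinity"
    using assms(2) by (simp add: filterlim_at_top_dense)
  then obtain b where b: "\<And>x. norm x \<ge> b \<Longrightarrow> W x > r"
    by (auto simp: eventually_at_infinity)
  have "bounded {x. W x \<le> r}"
    using b by (intro boundedI[of _ b]) (metis linorder_le_cases mem_Collect_eq not_less)
  moreover have "closed {x. W x \<le> r}"
    by (rule closed_Collect_le) (use assms in auto)
  ultimately show ?thesis by (simp add: compact_eq_bounded_closed)
qed

section \<open>The Huber function and its first order remainder\<close>

definition huber :: "real \<Rightarrow> real" where
  "huber s = (if s \<le> 0 then 0 else if s \<le> 1 then s\<^sup>2 / 2 else s - 1 / 2)"

text \<open>The derivative of \<open>huber\<close>. It is 1-Lipschitz, which is behind the quadratic
  remainder, and takes values between 0 and 1, which is behind the linear one.\<close>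

definition huber' :: "real \<Rightarrow> real" where
  "huber' s = max 0 (min 1 s)"

lemma huber_nonneg: "huber s \<ge> 0"
  by (simp add: huber_def)

lemma huber_ge: "s \<le> huber s + 1"
proof -
  have "0 \<le> (s - 1)\<^sup>2" by simp
  then show ?thesis by (auto simp: huber_def power2_eq_square algebra_simps)
qed

lemma huber_le: "huber s \<le> max 0 s"
  using mult_left_le[of s s] by (auto simp: huber_def power2_eq_square)

lemma huber'_range: "0 \<le> huber' s" "huber' s \<le> 1"
  by (auto simp: huber'_def)

lemma huber'_eq_0: "s \<le> 0 \<Longrightarrow> huber' s = 0"
  by (auto simp: huber'_def)

lemma continuous_huber': "continuous_on A huber'"
  unfolding huber'_def by (intro continuous_intros)

lemma huber_mono: "s \<le> t \<Longrightarrow> huber s \<le> huber t"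
proof -
  assume st: "s \<le> t"
  have "s\<^sup>2 \<le> t\<^sup>2" if "0 < s" using st that by (intro power_mono) auto
  moreover have "s\<^sup>2 \<le> 1" if "0 < s" "s \<le> 1" using that by (simp add: power_le_one)
  ultimately show ?thesis using st by (auto simp: huber_def)
qed

lemma huber_lipschitz: "s \<le> t \<Longrightarrow> huber t - huber s \<le> t - s"
proof -
  assume st: "s \<le> t"
  have *: "t\<^sup>2 \<le> t" if "0 < t" "t \<le> 1" for t :: real
    using mult_left_le[of t t] that by (simp add: power2_eq_square)
  have "t\<^sup>2 / 2 - s\<^sup>2 / 2 \<le> t - s" if "0 < s" "t \<le> 1"
  proof -
    have "(t - s) * (t + s) \<le> (t - s) * 2" using st that by (intro mult_left_mono) auto
    then show ?thesis by (simp add: power2_eq_square algebra_simps)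
  qed
  moreover have "1 / 2 - s\<^sup>2 / 2 \<le> 1 - s"
    using zero_le_power2[of "1 - s"] by (simp add: power2_eq_square algebra_simps)
  ultimately show ?thesis using st *[of t] *[of s] by (auto simp: huber_def)
qed

text \<open>Since the slope is 1-Lipschitz, the optimal constant is 1/2; the weaker constant 1
  suffices and leaves room in the case split on the position of \<open>s\<close>.\<close>

lemma huber_remainder_quadratic: "huber t - huber s - huber' s * (t - s) \<le> (t - s)\<^sup>2"
proof -
  have h: "huber t \<le> t\<^sup>2 / 2"
    using zero_le_power2[of "t - 1"] by (auto simp: huber_def power2_eq_square algebra_simps)
  consider "s \<le> 0" | "0 < s" "s \<le> 1" | "1 < s" by linarith
  then show ?thesis
  proof cases
    case 1
    have "huber t \<le> (t - s)\<^sup>2"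
    proof (cases "t \<le> 0")
      case False
      then have "t\<^sup>2 \<le> (t - s)\<^sup>2" using 1 by (intro power_mono) auto
      then show ?thesis using h zero_le_power2[of t] by linarith
    qed (simp add: huber_def)
    then show ?thesis using 1 by (simp add: huber_def huber'_def)
  next
    case 2
    have "t\<^sup>2 / 2 - s\<^sup>2 / 2 - s * (t - s) = (t - s)\<^sup>2 / 2"
      by (simp add: power2_eq_square algebra_simps)
    moreover have "huber s = s\<^sup>2 / 2" "huber' s = s"
      using 2 by (simp_all add: huber_def huber'_def)
    ultimately show ?thesis
      using h zero_le_power2[of "t - s"] by (smt (verit) field_sum_of_halves)
  next
    case 3
    show ?thesis
    proof (cases "t \<le> 1")
      case True
      have "(1 - t)\<^sup>2 \<le> (s - t)\<^sup>2" using True 3 by (intro power_mono) auto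
      moreover have "t\<^sup>2 / 2 - (t - 1 / 2) = (1 - t)\<^sup>2 / 2"
        by (simp add: power2_eq_square algebra_simps)
      moreover have "(t - s)\<^sup>2 = (s - t)\<^sup>2" by (rule power2_commute)
      moreover have "huber s = s - 1 / 2" "huber' s = 1"
        using 3 by (simp_all add: huber_def huber'_def)
      ultimately show ?thesis
        using h zero_le_power2[of "1 - t"] by (smt (verit) field_sum_of_halves mult_cancel_right1)
    next
      case False
      then show ?thesis using 3 by (simp add: huber_def huber'_def)
    qed
  qed
qed

text \<open>For large increments: later \<open>t - s\<close> is an increment of \<open>W\<close>, of
  order \<open>(norm u)\<^sup>2\<close> for large \<open>u\<close>, and squaring it would give a
  fourth power.\<close>

lemma huber_remainder_linear: "huber t - huber s - huber' s * (t - s) \<le> \<bar>t - s\<bar>"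
proof (cases "s \<le> t")
  case True
  then show ?thesis
    using huber_lipschitz[of s t] huber'_range[of s] mult_nonneg_nonneg[of "huber' s" "t - s"]
    by linarith
next
  case False
  then show ?thesis
    using huber_mono[of t s] huber'_range[of s] mult_right_mono[of "huber' s" 1 "s - t"]
    by (simp add: algebra_simps)
qed

lemma huber_remainder_0: "1 \<le> s \<Longrightarrow> 1 \<le> t \<Longrightarrow> huber t - huber s - huber' s * (t - s) = 0"
  by (auto simp: huber_def huber'_def)

text \<open>Where both values exceed \<open>m + 1\<close> the composition is affine in \<open>W\<close>; otherwise one of the two points lies in
  \<open>{W \<le> m + 1}\<close>, where the gradient is bounded, and this makes the remainder of the Huber
  function quadratic in the increment.\<close>
lemma huber_comp_remainder:
  fixes W :: "'a::euclidean_space \<Rightarrow> real"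
  assumes diff: "\<And>x. W differentiable (at x)"
    and lip: "\<And>x z. norm (grad W x - grad W z) \<le> L * norm (x - z)"
    and G: "\<And>x. W x \<le> m + 1 \<Longrightarrow> norm (grad W x) \<le> G"
    and L0: "L \<ge> 0" and G0: "G \<ge> 0"
  shows "huber (W (x + u) - m) \<le> huber (W x - m) + huber' (W x - m) * (grad W x \<bullet> u)
           + ((G + L)\<^sup>2 + G + 2 * L) * (norm u)\<^sup>2"
proof -
  define d where "d = W (x + u) - W x"
  let ?n = "norm u"
  let ?r = "huber (W (x + u) - m) - huber (W x - m) - huber' (W x - m) * d"
  have taylor: "\<bar>W (x + u) - W x - grad W x \<bullet> u\<bar> \<le> L * (norm u)\<^sup>2" for x u
    using diff lip by (rule lipschitz_grad_remainder)
  have r: "?r \<le> ((G + L)\<^sup>2 + G + L) * ?n\<^sup>2"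
  proof (cases "W x \<ge> m + 1 \<and> W (x + u) \<ge> m + 1")
    case True
    then show ?thesis
      using huber_remainder_0[of "W x - m" "W (x + u) - m"] G0 L0 by (simp add: d_def)
  next
    case False
    have cs: "\<bar>grad W z \<bullet> u\<bar> \<le> G * ?n" if "W z \<le> m + 1" for z
      using Cauchy_Schwarz_ineq2[of "grad W z" u] mult_right_mono[OF G[OF that], of ?n] by simp
    \<comment> \<open>Expand at whichever of the two points lies in \<open>{W \<le> m + 1}\<close>,
      because the bound \<open>G\<close> on the gradient holds only there; seen from
      \<open>x + u\<close> the increment is \<open>- u\<close>.\<close>
    have d: "\<bar>d\<bar> \<le> G * ?n + L * ?n\<^sup>2"
    proof (cases "W x \<le> m + 1")
      case True
      show ?thesis using cs[OF True] taylor[of x u] unfolding d_def by linarith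
    next
      case False
      with \<open>\<not> (W x \<ge> m + 1 \<and> W (x + u) \<ge> m + 1)\<close> have "W (x + u) \<le> m + 1" by linarith
      from cs[OF this] taylor[of "x + u" "- u"] show ?thesis unfolding d_def by simp
    qed
    \<comment> \<open>For short increments \<open>d\<close> is linear in \<open>?n\<close> and the
      quadratic remainder applies; for long ones \<open>d\<close> is of order
      \<open>?n\<^sup>2\<close> and the linear remainder gives the right power.\<close>
    show ?thesis
    proof (cases "?n \<le> 1")
      case True
      then have "?n\<^sup>2 \<le> ?n" using mult_left_le[of ?n ?n] by (simp add: power2_eq_square)
      then have "L * ?n\<^sup>2 \<le> L * ?n" using L0 by (rule mult_left_mono)
      then have "\<bar>d\<bar> \<le> (G + L) * ?n" using d by (simp add: algebra_simps)
      then have "d\<^sup>2 \<le> ((G + L) * ?n)\<^sup>2"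
        using power_mono[of "\<bar>d\<bar>" _ 2] by simp
      then have "?r \<le> (G + L)\<^sup>2 * ?n\<^sup>2"
        using huber_remainder_quadratic[of "W (x + u) - m" "W x - m"]
        by (simp add: d_def power_mult_distrib)
      also have "\<dots> \<le> ((G + L)\<^sup>2 + G + L) * ?n\<^sup>2"
        using G0 L0 by (intro mult_right_mono) auto
      finally show ?thesis .
    next
      case False
      then have "?n \<le> ?n\<^sup>2" using mult_left_mono[of 1 ?n ?n] by (simp add: power2_eq_square)
      then have "G * ?n \<le> G * ?n\<^sup>2" using G0 by (rule mult_left_mono)
      then have "?r \<le> (G + L) * ?n\<^sup>2"
        using d huber_remainder_linear[of "W (x + u) - m" "W x - m"]
        by (simp add: d_def algebra_simps)
      also have "\<dots> \<le> ((G + L)\<^sup>2 + G + L) * ?n\<^sup>2"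
        using G0 L0 by (intro mult_right_mono) auto
      finally show ?thesis .
    qed
  qed
  \<comment> \<open>Replacing \<open>d\<close> by its linear part costs a further
    \<open>L * ?n\<^sup>2\<close>, hence \<open>2 * L\<close> in the final constant.\<close>
  have "huber' (W x - m) * (d - grad W x \<bullet> u) \<le> 1 * (L * ?n\<^sup>2)"
    using taylor[of x u] huber'_range[of "W x - m"] L0
    by (smt (verit, best) d_def mult_left_le_one_le mult_nonneg_nonneg mult_nonneg_nonpos zero_le_power2)
  with r show ?thesis by (simp add: algebra_simps)
qed

section \<open>Perturbed descent\<close>

text \<open>Since \<open>w\<close> is bounded below, the divergent sum of steps forces a visit below
  \<open>m\<close>. After it \<open>m + e\<close> is never exceeded: a step from below
  \<open>m\<close> overshoots by at most \<open>\<eta> n < e\<close>, and a step from above only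
  descends.\<close>

lemma eventually_below_level:
  fixes w s \<eta> :: "nat \<Rightarrow> real"
  assumes down: "eventually (\<lambda>n. w n \<ge> m \<longrightarrow> w (Suc n) \<le> w n - c * s n) sequentially"
    and up: "eventually (\<lambda>n. w n < m \<longrightarrow> w (Suc n) \<le> m + \<eta> n) sequentially"
    and c: "c > 0" and s: "\<And>n. s n \<ge> 0"
    and s_inf: "filterlim (\<lambda>n. \<Sum>k<n. s k) at_top sequentially"
    and \<eta>: "\<eta> \<longlonglongrightarrow> 0" and lower: "\<And>n. w n \<ge> B" and e: "e > 0"
  shows "eventually (\<lambda>n. w n \<le> m + e) sequentially"
proof -
  have "eventually (\<lambda>n. \<eta> n < e) sequentially"
    using \<eta> e by (rule order_tendstoD)
  with down up have "eventually (\<lambda>n. (w n \<ge> m \<longrightarrow> w (Suc n) \<le> w n - c * s n) \<and>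
      (w n < m \<longrightarrow> w (Suc n) \<le> m + \<eta> n) \<and> \<eta> n < e) sequentially"
    by eventually_elim blast
  then have "eventually (\<lambda>n. (w n \<ge> m \<longrightarrow> w (Suc n) \<le> w n - c * s n) \<and>
      (w n < m \<longrightarrow> w (Suc n) \<le> m + e)) sequentially"
    by eventually_elim auto
  then obtain n0 where n0: "\<And>n. n \<ge> n0 \<Longrightarrow> w n \<ge> m \<Longrightarrow> w (Suc n) \<le> w n - c * s n"
      "\<And>n. n \<ge> n0 \<Longrightarrow> w n < m \<Longrightarrow> w (Suc n) \<le> m + e"
    unfolding eventually_sequentially by blast
  have "\<exists>n\<ge>n0. w n < m"
  proof (rule ccontr)
    assume "\<not> (\<exists>n\<ge>n0. w n < m)"
    then have m: "w n \<ge> m" if "n \<ge> n0" for n using that by force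
    have *: "w n + c * (\<Sum>k<n. s k) \<le> w n0 + c * (\<Sum>k<n0. s k)" if "n \<ge> n0" for n
      using that
    proof (induction n rule: dec_induct)
      case (step n)
      then show ?case using n0(1)[of n] m[of n] by (simp add: algebra_simps)
    qed simp
    have "eventually (\<lambda>n. (\<Sum>k<n. s k) > (w n0 + c * (\<Sum>k<n0. s k) - B) / c) sequentially"
      using s_inf by (simp add: filterlim_at_top_dense)
    with eventually_ge_at_top[of n0] have "eventually (\<lambda>n::nat. False) sequentially"
    proof eventually_elim
      case (elim n)
      then have "c * (\<Sum>k<n. s k) > w n0 + c * (\<Sum>k<n0. s k) - B"
        using c by (simp add: pos_divide_less_eq mult.commute)
      then show False using *[OF elim(1)] lower[of n] by linarith
    qed
    then show False by simp
  qed
  then obtain n1 where n1: "n1 \<ge> n0" "w n1 < m" by blast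
  have "w n \<le> m + e" if "n \<ge> n1" for n
    using that
  proof (induction n rule: dec_induct)
    case base
    then show ?case using n1 e by simp
  next
    case (step n)
    then have "n \<ge> n0" using n1 by simp
    show ?case
    proof (cases "w n < m")
      case False
      have "0 \<le> c * s n" using c s[of n] by simp
      then show ?thesis using n0(1)[OF \<open>n \<ge> n0\<close>] False step.IH by linarith
    qed (use n0(2)[OF \<open>n \<ge> n0\<close>] in auto)
  qed
  then show ?thesis unfolding eventually_sequentially by blast
qed

text \<open>Descent only yields \<open>W \<le> m\<close> in the limit, whereas the target is the
  closure of the strict sublevel set, which for a general function can be smaller. Here a point with
  \<open>W x = m\<close> is approached from inside along \<open>x + t *\<^sub>R h x\<close> for
  small \<open>t > 0\<close>, because the drift there is strictly negative.\<close>

lemma sublevel_le_closure: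
  fixes W :: "'a::euclidean_space \<Rightarrow> real"
  assumes diff: "\<And>x. W differentiable (at x)"
    and lip: "\<And>x z. norm (grad W x - grad W z) \<le> L * norm (x - z)"
    and drift: "\<And>x. W x \<ge> m \<Longrightarrow> h x \<bullet> grad W x < 0"
    and x: "W x \<le> m"
  shows "x \<in> closure {z. W z < m}"
proof (cases "W x < m")
  case True
  then show ?thesis by (intro subsetD[OF closure_subset]) simp
next
  case False
  with x have Wx: "W x = m" by simp
  let ?b = "- (h x \<bullet> grad W x)"
  have b: "?b > 0" using drift[of x] Wx by simp
  let ?p = "\<lambda>t. x + t *\<^sub>R h x"
  have lim: "(?p \<longlongrightarrow> x) (at_right 0)"
    by (auto intro!: tendsto_eq_intros)
  have "((\<lambda>t. \<bar>L\<bar> * t * (norm (h x))\<^sup>2) \<longlongrightarrow> 0) (at_right 0)"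
    by (auto intro!: tendsto_eq_intros)
  then have "eventually (\<lambda>t. \<bar>L\<bar> * t * (norm (h x))\<^sup>2 < ?b) (at_right 0)"
    using b by (rule order_tendstoD)
  moreover have "eventually (\<lambda>t::real. t > 0) (at_right 0)"
    by (simp add: eventually_at_right_less)
  ultimately have ev: "eventually (\<lambda>t. ?p t \<in> closure {z. W z < m}) (at_right 0)"
  proof eventually_elim
    case (elim t)
    have "\<bar>W (?p t) - W x - grad W x \<bullet> (t *\<^sub>R h x)\<bar> \<le> L * (norm (t *\<^sub>R h x))\<^sup>2"
      using diff lip by (rule lipschitz_grad_remainder)
    then have "W (?p t) \<le> W x - t * ?b + L * (norm (t *\<^sub>R h x))\<^sup>2"
      by (simp add: inner_commute)
    also have "L * (norm (t *\<^sub>R h x))\<^sup>2 \<le> \<bar>L\<bar> * (norm (t *\<^sub>R h x))\<^sup>2"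
      by (intro mult_right_mono) auto
    also have "\<dots> = t * (\<bar>L\<bar> * t * (norm (h x))\<^sup>2)"
      by (simp add: power_mult_distrib power2_eq_square)
    also have "W x - t * ?b + \<dots> < W x"
      using mult_strict_left_mono[OF elim(1,2)] by simp
    finally have "W (?p t) < m" using Wx by simp
    then show ?case by (intro subsetD[OF closure_subset]) simp
  qed
  show ?thesis
    by (rule Lim_in_closed_set[OF closed_closure ev _ lim]) simp
qed

text \<open>Adding the tail \<open>r n\<close> of the convergent noise series to \<open>x n\<close> gives a noiseless recursion
  for \<open>z n = x n + r n\<close>, along which \<open>W\<close> decreases by a multiple of the step size outside \<open>{W < m}\<close>.\<close>
lemma perturbed_descent_converges:
  fixes W :: "'a::euclidean_space \<Rightarrow> real" and x \<zeta> :: "nat \<Rightarrow> 'a"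
  assumes diff: "\<And>x. W differentiable (at x)"
    and lip: "\<And>x z. norm (grad W x - grad W z) \<le> L * norm (x - z)" and L0: "L \<ge> 0"
    and W0: "\<And>x. W x \<ge> 0" and coercive: "filterlim W at_top at_infinity"
    and h: "continuous_on UNIV h"
    and drift: "\<And>x. W x \<ge> m \<Longrightarrow> h x \<bullet> grad W x < 0"
    and s: "\<And>n. s n > 0" "s \<longlonglongrightarrow> 0" "filterlim (\<lambda>n. \<Sum>k<n. s k) at_top sequentially"
    and \<zeta>: "summable \<zeta>" and bdd: "\<And>n. W (x n) \<le> R"
    and rec: "\<And>n. x (Suc n) = x n + s n *\<^sub>R h (x n) + \<zeta> n"
  shows "(\<lambda>n. infdist (x n) (closure {z. W z < m})) \<longlonglongrightarrow> 0"
proof -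
  have contW: "continuous_on A W" for A
    using diff by (intro differentiable_imp_continuous_on) (auto simp: differentiable_on_def differentiable_at_withinI)
  have "L-lipschitz_on UNIV (grad W)"
    using lip L0 by (intro lipschitz_onI) (auto simp: dist_norm)
  then have contG: "continuous_on A (grad W)" for A
    using lipschitz_on_continuous_on continuous_on_subset by blast
  have conth: "continuous_on A h" for A using h continuous_on_subset by blast
  \<comment> \<open>\<open>infdist\<close> to an empty set is 0 by convention, but this set is
    nonempty: a minimiser of the coercive \<open>W\<close> has zero gradient, so by
    \<open>drift\<close> its value is below \<open>m\<close>.\<close>
  let ?C = "closure {z. W z < m}"
  define r where "r n = (suminf \<zeta>) - (\<Sum>k<n. \<zeta> k)" for n
  have r: "r \<longlonglongrightarrow> 0"
  proof -
    have "(\<lambda>n. (suminf \<zeta>) - (\<Sum>k<n. \<zeta> k)) \<longlonglongrightarrow> suminf \<zeta> - suminf \<zeta>"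
      by (intro tendsto_diff tendsto_const summable_LIMSEQ \<zeta>)
    then show ?thesis by (simp add: r_def[abs_def])
  qed
  define z where "z n = x n + r n" for n
  have zSuc: "z (Suc n) = z n + s n *\<^sub>R h (x n)" for n
    by (simp add: z_def r_def rec)
  \<comment> \<open>The closed unit neighbourhood of the sublevel set contains every
    \<open>x n\<close> and, once \<open>norm (r n) < 1\<close>, also \<open>z n\<close>; the
    constants below are uniform on this compact set.\<close>
  define K where "K = (\<Union>p\<in>{x. W x \<le> R}. \<Union>q\<in>cball 0 1. {p + q})"
  have "compact K"
    unfolding K_def by (intro compact_sums' compact_sublevel_coercive contW coercive compact_cball)
  have xK: "x n \<in> K" for n 
  proof -
    have "x n + 0 \<in> K" unfolding K_def using bdd[of n] by (intro UN_I[of "x n"] UN_I[of 0]) auto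
    then show ?thesis by simp
  qed
  have evr: "eventually (\<lambda>n. norm (r n) < 1) sequentially"
    using tendsto_norm[OF r] by (intro order_tendstoD) auto
  then have zK: "eventually (\<lambda>n. z n \<in> K) sequentially"
  proof eventually_elim
    case (elim n)
    then have "r n \<in> cball 0 1" "x n \<in> {x. W x \<le> R}" using bdd[of n] by auto
    then show ?case unfolding K_def z_def by blast
  qed
  have bd: "\<exists>B>0. \<forall>x\<in>K. norm (F x) \<le> B" if "continuous_on UNIV F" for F :: "'a \<Rightarrow> 'a"
    using compact_imp_bounded[OF compact_continuous_image[OF continuous_on_subset[OF that] \<open>compact K\<close>]]
    unfolding bounded_pos by auto
  obtain H where H: "H > 0" "\<And>x. x \<in> K \<Longrightarrow> norm (h x) \<le> H" using bd[OF conth] by blast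
  obtain G where G: "G > 0" "\<And>x. x \<in> K \<Longrightarrow> norm (grad W x) \<le> G" using bd[OF contG] by blast
  obtain \<delta> where \<delta>: "\<delta> > 0" "\<And>x. x \<in> K \<Longrightarrow> W x \<ge> m \<Longrightarrow> h x \<bullet> grad W x \<le> - \<delta>"
  proof (cases "K \<inter> {x. m \<le> W x} = {}")
    case True
    then show thesis using that[of 1] by auto
  next
    case False
    have "closed {x. m \<le> W x}" by (intro closed_Collect_le continuous_on_const contW)
    then have "compact (K \<inter> {x. m \<le> W x})" using \<open>compact K\<close> by (rule compact_Int_closed[rotated])
    moreover have "continuous_on (K \<inter> {x. m \<le> W x}) (\<lambda>x. h x \<bullet> grad W x)"
      by (intro continuous_intros conth contG)
    ultimately obtain u where u: "u \<in> K \<inter> {x. m \<le> W x}"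
        "\<And>x. x \<in> K \<inter> {x. m \<le> W x} \<Longrightarrow> h x \<bullet> grad W x \<le> h u \<bullet> grad W u"
      using continuous_attains_sup[OF _ False] by blast
    show thesis using that[of "- (h u \<bullet> grad W u)"] u drift[of u] by auto
  qed
  \<comment> \<open>The recursion for \<open>z\<close> uses the field at \<open>x n\<close>, while
    \<open>drift\<close> pairs it with the gradient at the same point, here \<open>z n\<close>. With
    this tolerance the mismatch costs at most \<open>\<delta> / 2\<close>.\<close>
  have hdiff: "eventually (\<lambda>n. norm (h (x n) - h (z n)) < \<delta> / (2 * G)) sequentially"
  proof -
    have "uniformly_continuous_on K h"
      by (intro compact_uniformly_continuous conth \<open>compact K\<close>)
    moreover have "\<delta> / (2 * G) > 0" using \<delta> G by simp
    ultimately obtain e where e: "e > 0"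
      "\<And>a b. a \<in> K \<Longrightarrow> b \<in> K \<Longrightarrow> dist b a < e \<Longrightarrow> dist (h b) (h a) < \<delta> / (2 * G)"
      unfolding uniformly_continuous_on_def by metis
    have "eventually (\<lambda>n. norm (r n) < e) sequentially"
      using tendsto_norm[OF r] e by (intro order_tendstoD) auto
    with zK show ?thesis
    proof eventually_elim
      case (elim n)
      then have "dist (x n) (z n) < e" by (simp add: z_def dist_norm)
      with e(2)[OF elim(1) xK[of n]] show ?case by (simp add: dist_norm)
    qed
  qed
  have step: "W (z (Suc n)) \<le> W (z n) + s n * (grad W (z n) \<bullet> h (x n)) + s n * (s n * (L * H\<^sup>2))" for n
  proof -
    have "\<bar>W (z n + s n *\<^sub>R h (x n)) - W (z n) - grad W (z n) \<bullet> (s n *\<^sub>R h (x n))\<bar>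
        \<le> L * (norm (s n *\<^sub>R h (x n)))\<^sup>2"
      using diff lip by (rule lipschitz_grad_remainder)
    also have "\<dots> \<le> L * (s n * H)\<^sup>2"
      using H(2)[OF xK[of n]] L0 s(1)[of n] by (intro mult_left_mono power_mono) auto
    finally show ?thesis
      by (simp add: zSuc power2_eq_square algebra_simps)
  qed
  \<comment> \<open>Of the drift \<open>\<delta>\<close>, half is lost to the mismatch and a quarter
    to the second order term, leaving \<open>\<delta> / 4\<close>.\<close>
  have down: "eventually (\<lambda>n. W (z n) \<ge> m \<longrightarrow> W (z (Suc n)) \<le> W (z n) - \<delta> / 4 * s n) sequentially"
  proof -
    have "(\<lambda>n. s n * (L * H\<^sup>2)) \<longlonglongrightarrow> 0"
      using s(2) by (auto intro!: tendsto_eq_intros)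
    then have "eventually (\<lambda>n. s n * (L * H\<^sup>2) < \<delta> / 4) sequentially"
      by (rule order_tendstoD) (use \<delta> in simp)
    with hdiff zK show ?thesis
    proof eventually_elim
      case (elim n)
      show ?case
      proof
        assume m: "W (z n) \<ge> m"
        have "\<bar>grad W (z n) \<bullet> (h (x n) - h (z n))\<bar> \<le> G * (\<delta> / (2 * G))"
          using elim(1) by (intro order_trans[OF Cauchy_Schwarz_ineq2] mult_mono G(2) elim(2)) (use G in auto)
        also have "\<dots> = \<delta> / 2" using G by simp
        finally have "grad W (z n) \<bullet> (h (x n) - h (z n)) \<le> \<delta> / 2"
          by (rule abs_le_D1)
        then have "grad W (z n) \<bullet> h (x n) \<le> - \<delta> / 2"
          using \<delta>(2)[OF elim(2) m] by (simp add: inner_diff_right inner_commute)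
        then have "s n * (grad W (z n) \<bullet> h (x n)) + s n * (s n * (L * H\<^sup>2)) \<le> s n * (- \<delta> / 2) + s n * (\<delta> / 4)"
          using s(1)[of n] elim(3) by (intro add_mono mult_left_mono) auto
        then show "W (z (Suc n)) \<le> W (z n) - \<delta> / 4 * s n"
          using step[of n] by (simp add: algebra_simps)
      qed
    qed
  qed
  define \<eta> where "\<eta> n = s n * (G * H) + s n * (s n * (L * H\<^sup>2))" for n
  have \<eta>: "\<eta> \<longlonglongrightarrow> 0"
    unfolding \<eta>_def[abs_def] using s(2) by (auto intro!: tendsto_eq_intros)
  have up: "eventually (\<lambda>n. W (z n) < m \<longrightarrow> W (z (Suc n)) \<le> m + \<eta> n) sequentially"
    using zK
  proof eventually_elim
    case (elim n)
    have "\<bar>grad W (z n) \<bullet> h (x n)\<bar> \<le> G * H"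
      by (intro order_trans[OF Cauchy_Schwarz_ineq2] mult_mono G(2) H(2) elim xK) (use G in auto)
    then have "s n * (grad W (z n) \<bullet> h (x n)) \<le> s n * (G * H)"
      using s(1)[of n] by (intro mult_left_mono) auto
    then show ?case using step[of n] by (auto simp: \<eta>_def)
  qed
  show ?thesis
  proof (rule LIMSEQ_I)
    fix e :: real assume e: "e > 0"
    \<comment> \<open>If this compact set is nonempty, the minimum of \<open>W\<close> on it exceeds
      \<open>m\<close>, because points with \<open>W \<le> m\<close> lie in \<open>?C\<close>. So
      \<open>W (z n) < w\<close> puts \<open>z n\<close> within \<open>e / 2\<close> of
      \<open>?C\<close>; the other half of \<open>e\<close> absorbs \<open>r n\<close>.\<close>
    let ?Q = "K \<inter> {x. e / 2 \<le> infdist x ?C}"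
    obtain w where w: "w > m" "\<And>x. x \<in> ?Q \<Longrightarrow> w \<le> W x"
    proof (cases "?Q = {}")
      case True
      then show thesis using that[of "m + 1"] by auto
    next
      case False
      have "closed {x. e / 2 \<le> infdist x ?C}"
        by (intro closed_Collect_le continuous_intros)
      then have "compact ?Q" using \<open>compact K\<close> by (rule compact_Int_closed[rotated])
      then obtain u where u: "u \<in> ?Q" "\<And>x. x \<in> ?Q \<Longrightarrow> W u \<le> W x"
        using continuous_attains_inf[OF _ False contW] by blast
      have "W u > m"
      proof (rule ccontr)
        assume "\<not> W u > m"
        then have "u \<in> ?C" using sublevel_le_closure[OF diff lip drift] by force
        then show False using u(1) e by simp
      qed
      then show thesis using that u(2) by blast
    qed
    have "eventually (\<lambda>n. W (z n) \<le> m + (w - m) / 2) sequentially"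
      by (rule eventually_below_level[OF down up _ _ s(3) \<eta> W0]) (use \<delta> w less_imp_le[OF s(1)] in simp_all)
    moreover have "eventually (\<lambda>n. norm (r n) < e / 2) sequentially"
      using tendsto_norm[OF r] e by (intro order_tendstoD) auto
    ultimately have "eventually (\<lambda>n. norm (infdist (x n) ?C - 0) < e) sequentially"
      using zK
    proof eventually_elim
      case (elim n)
      have "z n \<notin> ?Q" using w(2)[of "z n"] elim(1) w(1) by (auto simp: field_simps)
      then have "infdist (z n) ?C < e / 2" using elim(3) by auto
      moreover have "infdist (x n) ?C \<le> infdist (z n) ?C + dist (x n) (z n)"
        by (rule infdist_triangle)
      ultimately show ?case
        using elim(2) infdist_nonneg[of "x n" ?C] by (simp add: z_def dist_norm)
    qed
    then show "\<exists>no. \<forall>n\<ge>no. norm (infdist (x n) ?C - 0) < e"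
      unfolding eventually_sequentially .
  qed
qed

section \<open>Maximal inequality and square integrable martingales\<close>

text \<open>Ville's maximal inequality, in a form where the supermartingale property is only needed
  on the event that the level \<open>c\<close> has not yet been reached.\<close>
lemma maximal_inequality:
  fixes X :: "nat \<Rightarrow> 'w \<Rightarrow> ennreal" and b :: "nat \<Rightarrow> ennreal"
  assumes X[measurable]: "\<And>k. X k \<in> borel_measurable P"
    and step: "\<And>k. (\<integral>\<^sup>+\<omega>. X (Suc k) \<omega> * indicator {\<omega> \<in> space P. \<forall>j\<le>k. X j \<omega> < c} \<omega> \<partial>P)
        \<le> (\<integral>\<^sup>+\<omega>. X k \<omega> * indicator {\<omega> \<in> space P. \<forall>j\<le>k. X j \<omega> < c} \<omega> \<partial>P) + b k"
  shows "c * emeasure P {\<omega> \<in> space P. \<exists>j. c \<le> X j \<omega>} \<le> (\<integral>\<^sup>+\<omega>. X 0 \<omega> \<partial>P) + (\<Sum>k. b k)"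
proof -
  let ?U = "\<lambda>n. {\<omega> \<in> space P. \<exists>j<n. c \<le> X j \<omega>}"
  let ?B = "\<lambda>n. {\<omega> \<in> space P. \<forall>j<n. X j \<omega> < c}"
  have B_Suc: "{\<omega> \<in> space P. \<forall>j\<le>k. X j \<omega> < c} = ?B (Suc k)" for k
    by (simp add: less_Suc_eq_le)
  \<comment> \<open>The left side is a budget: \<open>c\<close> times the mass that has crossed
    before time \<open>n\<close>, plus the integral of \<open>X n\<close> over the surviving event.
    Crossing at time \<open>n\<close> moves mass from the second term to the first without
    increasing the total, and \<open>step\<close> controls the survivors.\<close>
  have ind: "c * emeasure P (?U n) + (\<integral>\<^sup>+\<omega>. X n \<omega> * indicator (?B n) \<omega> \<partial>P)
      \<le> (\<integral>\<^sup>+\<omega>. X 0 \<omega> \<partial>P) + (\<Sum>k<n. b k)" for n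
  proof (induction n)
    case 0
    have "(\<integral>\<^sup>+\<omega>. X 0 \<omega> * indicator (?B 0) \<omega> \<partial>P) \<le> (\<integral>\<^sup>+\<omega>. X 0 \<omega> \<partial>P)"
      by (intro nn_integral_mono) (auto split: split_indicator)
    then show ?case by simp
  next
    case (Suc n)
    let ?H = "{\<omega> \<in> ?B n. c \<le> X n \<omega>}"
    have H[measurable]: "?H \<in> sets P" by measurable
    have "?U (Suc n) = ?U n \<union> ?H"
      by (auto simp: less_Suc_eq not_less)
    moreover have "?U n \<inter> ?H = {}" by (auto simp: not_le)
    ultimately have U: "emeasure P (?U (Suc n)) = emeasure P (?U n) + emeasure P ?H"
      by (simp add: plus_emeasure)
    have "c * emeasure P ?H + (\<integral>\<^sup>+\<omega>. X n \<omega> * indicator (?B (Suc n)) \<omega> \<partial>P)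
        = (\<integral>\<^sup>+\<omega>. c * indicator ?H \<omega> + X n \<omega> * indicator (?B (Suc n)) \<omega> \<partial>P)"
      by (simp add: nn_integral_add nn_integral_cmult_indicator)
    also have "\<dots> \<le> (\<integral>\<^sup>+\<omega>. X n \<omega> * indicator (?B n) \<omega> \<partial>P)"
      by (intro nn_integral_mono) (auto simp: less_Suc_eq not_le split: split_indicator)
    finally have X: "c * emeasure P ?H + (\<integral>\<^sup>+\<omega>. X n \<omega> * indicator (?B (Suc n)) \<omega> \<partial>P)
        \<le> (\<integral>\<^sup>+\<omega>. X n \<omega> * indicator (?B n) \<omega> \<partial>P)" .
    have "c * emeasure P (?U (Suc n)) + (\<integral>\<^sup>+\<omega>. X (Suc n) \<omega> * indicator (?B (Suc n)) \<omega> \<partial>P)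
        \<le> c * emeasure P (?U n) + (c * emeasure P ?H
          + (\<integral>\<^sup>+\<omega>. X n \<omega> * indicator (?B (Suc n)) \<omega> \<partial>P)) + b n"
      using add_left_mono[OF step[of n, unfolded B_Suc]] by (simp add: U distrib_left add.assoc)
    also have "\<dots> \<le> c * emeasure P (?U n) + (\<integral>\<^sup>+\<omega>. X n \<omega> * indicator (?B n) \<omega> \<partial>P) + b n"
      by (intro add_mono X order_refl)
    also have "\<dots> \<le> (\<integral>\<^sup>+\<omega>. X 0 \<omega> \<partial>P) + (\<Sum>k<Suc n. b k)"
      using add_right_mono[OF Suc.IH, of "b n"] by (simp add: add.assoc)
    finally show ?case .
  qed
  have "c * emeasure P (?U n) \<le> (\<integral>\<^sup>+\<omega>. X 0 \<omega> \<partial>P) + (\<Sum>k. b k)" for n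
  proof -
    have "c * emeasure P (?U n) \<le> (\<integral>\<^sup>+\<omega>. X 0 \<omega> \<partial>P) + (\<Sum>k<n. b k)"
      using ind[of n] by (rule order_trans[rotated]) simp
    also have "(\<Sum>k<n. b k) \<le> (\<Sum>k. b k)"
      by (rule sum_le_suminf) auto
    finally show ?thesis by simp
  qed
  then have "(SUP n. c * emeasure P (?U n)) \<le> (\<integral>\<^sup>+\<omega>. X 0 \<omega> \<partial>P) + (\<Sum>k. b k)"
    by (rule SUP_least)
  moreover have "(SUP n. emeasure P (?U n)) = emeasure P (\<Union>n. ?U n)"
    by (rule SUP_emeasure_incseq) (auto simp: incseq_def intro: less_le_trans)
  moreover have "(\<Union>n. ?U n) = {\<omega> \<in> space P. \<exists>j. c \<le> X j \<omega>}"
    by auto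
  ultimately show ?thesis by (simp flip: SUP_mult_left_ennreal)
qed

text \<open>The maximal inequality has the same finite right side for every level \<open>r\<close>,
  so the event of reaching all levels, \<open>r\<close> times whose measure stays bounded, is null.
  The hypothesis is again localised below each level, where the application has its
  integrability.\<close>

lemma AE_bounded_supermartingale:
  fixes X :: "nat \<Rightarrow> 'w \<Rightarrow> ennreal"
  assumes X[measurable]: "\<And>k. X k \<in> borel_measurable P"
    and step: "\<And>c k. (\<integral>\<^sup>+\<omega>. X (Suc k) \<omega> * indicator {\<omega> \<in> space P. \<forall>j\<le>k. X j \<omega> < ennreal c} \<omega> \<partial>P)
        \<le> (\<integral>\<^sup>+\<omega>. X k \<omega> * indicator {\<omega> \<in> space P. \<forall>j\<le>k. X j \<omega> < ennreal c} \<omega> \<partial>P)"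
    and X0: "(\<integral>\<^sup>+\<omega>. X 0 \<omega> \<partial>P) < \<infinity>"
  shows "AE \<omega> in P. \<exists>r::nat. \<forall>k. X k \<omega> < ennreal (real r)"
proof -
  let ?E = "{\<omega> \<in> space P. \<forall>r::nat. \<exists>k. ennreal (real r) \<le> X k \<omega>}"
  have E: "?E \<in> sets P" by measurable
  obtain C where C: "(\<integral>\<^sup>+\<omega>. X 0 \<omega> \<partial>P) = ennreal C" "C \<ge> 0"
    using X0 by (auto simp: less_top_ennreal)
  have bound: "ennreal (real r) * emeasure P ?E \<le> ennreal C" for r :: nat
  proof -
    have "ennreal (real r) * emeasure P {\<omega> \<in> space P. \<exists>j. ennreal (real r) \<le> X j \<omega>}
        \<le> (\<integral>\<^sup>+\<omega>. X 0 \<omega> \<partial>P) + (\<Sum>k. (0::ennreal))"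
      by (rule maximal_inequality) (use step in auto)
    moreover have "emeasure P ?E \<le> emeasure P {\<omega> \<in> space P. \<exists>j. ennreal (real r) \<le> X j \<omega>}"
      by (intro emeasure_mono) auto
    ultimately show ?thesis
      using C(1) mult_left_mono[of "emeasure P ?E" _ "ennreal (real r)"] by (auto intro: order_trans)
  qed
  have "emeasure P ?E = 0"
  proof (cases "emeasure P ?E")
    case (real p)
    have "p * real r \<le> C" for r :: nat
      using bound[of r] real C(2) by (simp add: ennreal_mult[symmetric] mult.commute)
    then have "p \<le> 0" using real
      by (metis dual_order.refl ex_less_of_nat_mult less_eq_real_def mult.commute not_less)
    then show ?thesis using real by simp
  next
    case top
    then show ?thesis using bound[of 1] by (simp add: top_unique)
  qed
  then have "AE \<omega> in P. \<omega> \<notin> ?E" using E by (intro AE_not_in) auto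
  then show ?thesis by (rule AE_mp) (auto simp: not_le)
qed

text \<open>The maximal inequality for \<open>\<parallel>S (m + k) - S m\<parallel>\<^sup>2\<close> shows that the partial sums \<open>S\<close>
  are almost surely Cauchy.\<close>
lemma (in prob_space) martingale_differences_summable:
  fixes D :: "nat \<Rightarrow> 'a \<Rightarrow> 'b::euclidean_space"
  assumes F: "\<And>k. subalgebra M (F k)"
    and F_mono: "\<And>k l. k \<le> l \<Longrightarrow> sets (F k) \<subseteq> sets (F l)"
    and D: "\<And>k. D k \<in> borel_measurable (F (Suc k))"
    and orth: "\<And>k \<xi> B. \<xi> \<in> borel_measurable (F k) \<Longrightarrow> (\<And>\<omega>. norm (\<xi> \<omega>) \<le> B) \<Longrightarrow> (\<integral>\<omega>. \<xi> \<omega> \<bullet> D k \<omega> \<partial>M) = 0"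
    and sq: "\<And>k. integrable M (\<lambda>\<omega>. (norm (D k \<omega>))\<^sup>2)" "\<And>k. (\<integral>\<omega>. (norm (D k \<omega>))\<^sup>2 \<partial>M) \<le> b k"
    and b: "summable b"
  shows "AE \<omega> in M. summable (\<lambda>k. D k \<omega>)"
proof -
  have sp: "space (F k) = space M" for k using F[of k] by (simp add: subalgebra_def)
  have F_meas: "\<xi> \<in> borel_measurable (F l)" if "\<xi> \<in> borel_measurable (F k)" "k \<le> l"
    for k l and \<xi> :: "'a \<Rightarrow> 'b"
    using that(1) F_mono[OF that(2)] by (auto simp: measurable_def sp)
  have b0: "b k \<ge> 0" for k
    using sq(2)[of k] by (rule order_trans[rotated]) (simp add: integral_nonneg_AE)
  define T where "T m k \<omega> = (\<Sum>j\<in>{m..<m+k}. D j \<omega>)" for m k \<omega>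
  have TF: "T m k \<in> borel_measurable (F (m + k))" for m k
    unfolding T_def[abs_def] by (intro borel_measurable_sum F_meas[OF D]) auto
  have DM[measurable]: "D k \<in> borel_measurable M" for k
    by (rule measurable_from_subalg[OF F D])
  have TM[measurable]: "T m k \<in> borel_measurable M" for m k
    by (rule measurable_from_subalg[OF F TF])
  have T_Suc: "T m (Suc k) \<omega> = T m k \<omega> + D (m + k) \<omega>" for m k \<omega>
    by (simp add: T_def)
  have tail: "ennreal (c\<^sup>2) * emeasure M {\<omega> \<in> space M. \<exists>k. c \<le> norm (T m k \<omega>)} \<le> ennreal (\<Sum>k. b (k + m))"
    if c: "c > 0" for c m
  proof -
    let ?X = "\<lambda>k \<omega>. ennreal ((norm (T m k \<omega>))\<^sup>2)"
    have lt: "?X k \<omega> < ennreal (c\<^sup>2) \<longleftrightarrow> norm (T m k \<omega>) < c" for k \<omega>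
    proof -
      have "(norm (T m k \<omega>))\<^sup>2 < c\<^sup>2 \<longleftrightarrow> norm (T m k \<omega>) < c"
        using power2_less_imp_less[of "norm (T m k \<omega>)" c] c
          power_strict_mono[of "norm (T m k \<omega>)" c 2] by auto
      then show ?thesis by (simp add: ennreal_less_iff)
    qed
    have "ennreal (c\<^sup>2) * emeasure M {\<omega> \<in> space M. \<exists>k. ennreal (c\<^sup>2) \<le> ?X k \<omega>}
        \<le> (\<integral>\<^sup>+\<omega>. ?X 0 \<omega> \<partial>M) + (\<Sum>k. ennreal (b (k + m)))"
    proof (rule maximal_inequality)
      fix k
      define B where "B = {\<omega> \<in> space M. \<forall>j\<le>k. norm (T m j \<omega>) < c}"
      have "B = (\<Inter>j\<in>{..k}. {\<omega> \<in> space (F (m + k)). norm (T m j \<omega>) < c})"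
        by (auto simp: B_def sp)
      also have "\<dots> \<in> sets (F (m + k))"
      proof (intro sets.finite_INT)
        fix j assume "j \<in> {..k}"
        then have [measurable]: "T m j \<in> borel_measurable (F (m + k))" by (intro F_meas[OF TF]) auto
        show "{\<omega> \<in> space (F (m + k)). norm (T m j \<omega>) < c} \<in> sets (F (m + k))" by measurable
      qed auto
      finally have BF[measurable]: "B \<in> sets (F (m + k))" .
      then have BM[measurable]: "B \<in> sets M" using F[of "m + k"] by (auto simp: subalgebra_def)
      \<comment> \<open>Before the first passage of \<open>c\<close> the partial sum is bounded by
        \<open>c\<close>, so this is an admissible weight in \<open>orth\<close> and the cross term
        of the expanded square vanishes.\<close>
      let ?\<xi> = "\<lambda>\<omega>. indicator B \<omega> *\<^sub>R T m k \<omega>"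
      have \<xi>F: "?\<xi> \<in> borel_measurable (F (m + k))" using TF[of m k] by measurable
      have \<xi>b: "norm (?\<xi> \<omega>) \<le> c" for \<omega> using c by (auto simp: B_def split: split_indicator intro: less_imp_le)
      have int1: "integrable M (\<lambda>\<omega>. (norm (T m k \<omega>))\<^sup>2 * indicator B \<omega>)"
        by (rule integrable_const_bound[where B = "c\<^sup>2"])
          (auto simp: B_def split: split_indicator intro!: AE_I2 less_imp_le[OF power_strict_mono])
      have int2: "integrable M (\<lambda>\<omega>. ?\<xi> \<omega> \<bullet> D (m + k) \<omega>)"
      proof (rule Bochner_Integration.integrable_bound)
        show "integrable M (\<lambda>\<omega>. c * (1 + (norm (D (m + k) \<omega>))\<^sup>2))" using sq(1) by auto
        show "AE \<omega> in M. norm (?\<xi> \<omega> \<bullet> D (m + k) \<omega>) \<le> norm (c * (1 + (norm (D (m + k) \<omega>))\<^sup>2))"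
        proof (rule AE_I2)
          fix \<omega>
          have "norm (?\<xi> \<omega> \<bullet> D (m + k) \<omega>) \<le> c * norm (D (m + k) \<omega>)"
            using Cauchy_Schwarz_ineq2[of "?\<xi> \<omega>" "D (m + k) \<omega>"] mult_right_mono[OF \<xi>b[of \<omega>], of "norm (D (m + k) \<omega>)"]
            by simp
          also have "\<dots> \<le> c * (1 + (norm (D (m + k) \<omega>))\<^sup>2)"
          proof -
            have "0 \<le> (norm (D (m + k) \<omega>) - 1 / 2)\<^sup>2" by simp
            then have "norm (D (m + k) \<omega>) \<le> 1 + (norm (D (m + k) \<omega>))\<^sup>2"
              by (simp add: power2_eq_square algebra_simps)
            then show ?thesis using c by (intro mult_left_mono) auto
          qed
          finally show "norm (?\<xi> \<omega> \<bullet> D (m + k) \<omega>) \<le> norm (c * (1 + (norm (D (m + k) \<omega>))\<^sup>2))" by simp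
        qed
      qed measurable
      have "(\<integral>\<^sup>+\<omega>. ?X (Suc k) \<omega> * indicator B \<omega> \<partial>M)
          \<le> (\<integral>\<^sup>+\<omega>. ennreal ((norm (T m k \<omega>))\<^sup>2 * indicator B \<omega> + 2 * (?\<xi> \<omega> \<bullet> D (m + k) \<omega>)
               + (norm (D (m + k) \<omega>))\<^sup>2) \<partial>M)"
        by (intro nn_integral_mono)
          (auto simp: T_Suc power2_norm_eq_inner inner_add_left inner_add_right inner_commute add_ac
            split: split_indicator)
      also have "\<dots> = ennreal (\<integral>\<omega>. (norm (T m k \<omega>))\<^sup>2 * indicator B \<omega> + 2 * (?\<xi> \<omega> \<bullet> D (m + k) \<omega>)
               + (norm (D (m + k) \<omega>))\<^sup>2 \<partial>M)"
      proof (intro nn_integral_eq_integral AE_I2)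
        show "0 \<le> (norm (T m k \<omega>))\<^sup>2 * indicator B \<omega> + 2 * (?\<xi> \<omega> \<bullet> D (m + k) \<omega>) + (norm (D (m + k) \<omega>))\<^sup>2" for \<omega>
        proof (cases "\<omega> \<in> B")
          case True
          have "0 \<le> (norm (T m k \<omega> + D (m + k) \<omega>))\<^sup>2" by simp
          then show ?thesis using True
            by (simp add: power2_norm_eq_inner inner_add_left inner_add_right inner_commute)
        qed simp
      qed (use int1 int2 sq(1) in auto)
      also have "(\<integral>\<omega>. (norm (T m k \<omega>))\<^sup>2 * indicator B \<omega> + 2 * (?\<xi> \<omega> \<bullet> D (m + k) \<omega>)
               + (norm (D (m + k) \<omega>))\<^sup>2 \<partial>M)
          = (\<integral>\<omega>. (norm (T m k \<omega>))\<^sup>2 * indicator B \<omega> \<partial>M) + (\<integral>\<omega>. (norm (D (m + k) \<omega>))\<^sup>2 \<partial>M)"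
        using int1 int2 sq(1)[of "m + k"] orth[OF \<xi>F \<xi>b] by simp
      also have "ennreal \<dots> \<le> ennreal (\<integral>\<omega>. (norm (T m k \<omega>))\<^sup>2 * indicator B \<omega> \<partial>M) + ennreal (b (k + m))"
        using sq(2)[of "m + k"] by (subst ennreal_plus[symmetric])
          (auto intro!: integral_nonneg_AE ennreal_leI simp: b0 add.commute)
      also have "ennreal (\<integral>\<omega>. (norm (T m k \<omega>))\<^sup>2 * indicator B \<omega> \<partial>M)
          = (\<integral>\<^sup>+\<omega>. ennreal ((norm (T m k \<omega>))\<^sup>2 * indicator B \<omega>) \<partial>M)"
        by (intro nn_integral_eq_integral[symmetric] int1) auto
      also have "\<dots> = (\<integral>\<^sup>+\<omega>. ?X k \<omega> * indicator B \<omega> \<partial>M)"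
        by (intro nn_integral_cong) (auto split: split_indicator)
      finally show "(\<integral>\<^sup>+\<omega>. ?X (Suc k) \<omega> * indicator {\<omega> \<in> space M. \<forall>j\<le>k. ?X j \<omega> < ennreal (c\<^sup>2)} \<omega> \<partial>M)
          \<le> (\<integral>\<^sup>+\<omega>. ?X k \<omega> * indicator {\<omega> \<in> space M. \<forall>j\<le>k. ?X j \<omega> < ennreal (c\<^sup>2)} \<omega> \<partial>M) + ennreal (b (k + m))"
        unfolding lt B_def .
    qed measurable
    also have "{\<omega> \<in> space M. \<exists>k. ennreal (c\<^sup>2) \<le> ?X k \<omega>} = {\<omega> \<in> space M. \<exists>k. c \<le> norm (T m k \<omega>)}"
      by (simp only: lt not_less[symmetric])
    also have "(\<integral>\<^sup>+\<omega>. ?X 0 \<omega> \<partial>M) = 0" by (simp add: T_def)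
    also have "(\<Sum>k. ennreal (b (k + m))) = ennreal (\<Sum>k. b (k + m))"
      using b b0 by (intro suminf_ennreal2) (auto simp: summable_iff_shift)
    finally show ?thesis by simp
  qed
  \<comment> \<open>The bad event lies in the exceedance event for every starting index
    \<open>m\<close>, so its probability is dominated by arbitrarily late tails of the convergent
    series of \<open>b\<close>.\<close>
  have "AE \<omega> in M. \<exists>m. \<forall>k. norm (T m k \<omega>) < c" if c: "c > 0" for c
  proof -
    let ?E = "{\<omega> \<in> space M. \<forall>m. \<exists>k. c \<le> norm (T m k \<omega>)}"
    have E: "?E \<in> sets M" by measurable
    have "(\<lambda>m. \<Sum>k. b (k + m)) \<longlonglongrightarrow> 0"
      using tendsto_diff[OF tendsto_const summable_LIMSEQ[OF b], of "suminf b"] b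
      by (simp add: suminf_minus_initial_segment)
    then have lim: "(\<lambda>m. ennreal (\<Sum>k. b (k + m))) \<longlonglongrightarrow> ennreal 0"
      by (rule tendsto_ennrealI)
    have "ennreal (c\<^sup>2) * emeasure M ?E \<le> ennreal 0"
    proof (rule LIMSEQ_le_const[OF lim], intro exI allI impI)
      fix m
      have "emeasure M ?E \<le> emeasure M {\<omega> \<in> space M. \<exists>k. c \<le> norm (T m k \<omega>)}"
        by (intro emeasure_mono) auto
      then show "ennreal (c\<^sup>2) * emeasure M ?E \<le> ennreal (\<Sum>k. b (k + m))"
        using tail[OF c, of m] mult_left_mono[of "emeasure M ?E" _ "ennreal (c\<^sup>2)"]
        by (auto intro: order_trans)
    qed
    then have "emeasure M ?E = 0" using c by simp
    then have "AE \<omega> in M. \<omega> \<notin> ?E" using E by (intro AE_not_in) auto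
    then show ?thesis by (rule AE_mp) (auto simp: not_le)
  qed
  then have "AE \<omega> in M. \<forall>i::nat. \<exists>m. \<forall>k. norm (T m k \<omega>) < 1 / (real i + 1)"
    by (subst AE_all_countable) auto
  then show ?thesis
  proof (rule AE_mp, intro AE_I2 impI)
    fix \<omega> assume *: "\<forall>i::nat. \<exists>m. \<forall>k. norm (T m k \<omega>) < 1 / (real i + 1)"
    show "summable (\<lambda>k. D k \<omega>)"
      unfolding summable_Cauchy
    proof (intro allI impI)
      fix e :: real assume "e > 0"
      then obtain i :: nat where i: "1 / (real i + 1) < e / 2"
        using reals_Archimedean[of "e / 2"] by (auto simp: inverse_eq_divide add.commute)
      obtain m where m: "\<And>k. norm (T m k \<omega>) < 1 / (real i + 1)" using * by blast
      have "norm (\<Sum>j = p..<q. D j \<omega>) < e" if "p \<ge> m" for p q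
      proof (cases "p \<le> q")
        case True
        have "(\<Sum>j = m..<p. D j \<omega>) + (\<Sum>j = p..<q. D j \<omega>) = (\<Sum>j = m..<q. D j \<omega>)"
          using that True by (rule sum.atLeastLessThan_concat)
        then have "(\<Sum>j = p..<q. D j \<omega>) = T m (q - m) \<omega> - T m (p - m) \<omega>"
          using that True by (simp add: T_def algebra_simps)
        then have "norm (\<Sum>j = p..<q. D j \<omega>) \<le> norm (T m (q - m) \<omega>) + norm (T m (p - m) \<omega>)"
          by (simp add: norm_triangle_ineq4)
        then show ?thesis using m[of "q - m"] m[of "p - m"] i by linarith
      qed (use \<open>e > 0\<close> in simp)
      then show "\<exists>N. \<forall>p\<ge>N. \<forall>q. norm (\<Sum>j = p..<q. D j \<omega>) < e" by blast
    qed
  qed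
qed

text \<open>Turns a vanishing conditional mean into orthogonality to bounded
  \<open>F\<close>-measurable weights, the only form in which (A3)(i) is used. The products are
  integrable because \<open>norm (Z \<omega>) \<le> 1 + (norm (Z \<omega>))\<^sup>2\<close>.\<close>

lemma (in finite_measure_subalgebra) vec_cond_exp_orthogonal:
  fixes Z \<xi> :: "'a \<Rightarrow> real ^ 'd"
  assumes Z: "Z \<in> borel_measurable M" "integrable M (\<lambda>\<omega>. (norm (Z \<omega>))\<^sup>2)"
    and zero: "AE \<omega> in M. vec_cond_exp M F Z \<omega> = 0"
    and \<xi>: "\<xi> \<in> borel_measurable F" "\<And>\<omega>. norm (\<xi> \<omega>) \<le> B"
  shows "integrable M (\<lambda>\<omega>. \<xi> \<omega> \<bullet> Z \<omega>)" "(\<integral>\<omega>. \<xi> \<omega> \<bullet> Z \<omega> \<partial>M) = 0"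
proof -
  have \<xi>M: "\<xi> \<in> borel_measurable M" by (rule measurable_from_subalg[OF subalg \<xi>(1)])
  have B0: "B \<ge> 0" using \<xi>(2) norm_ge_zero order_trans by blast
  have Zi: "(\<lambda>\<omega>. Z \<omega> $ i) \<in> borel_measurable M" for i
    by (rule measurable_compose[OF Z(1) borel_measurable_continuous_onI]) (intro continuous_intros)
  have \<xi>i: "(\<lambda>\<omega>. \<xi> \<omega> $ i) \<in> borel_measurable F" for i
    by (rule measurable_compose[OF \<xi>(1) borel_measurable_continuous_onI]) (intro continuous_intros)
  have int: "integrable M (\<lambda>\<omega>. \<xi> \<omega> $ i * Z \<omega> $ i)" for i
  proof (rule Bochner_Integration.integrable_bound)
    show "integrable M (\<lambda>\<omega>. B * (1 + (norm (Z \<omega>))\<^sup>2))" using Z(2) by auto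
    show "(\<lambda>\<omega>. \<xi> \<omega> $ i * Z \<omega> $ i) \<in> borel_measurable M"
      using Zi measurable_from_subalg[OF subalg \<xi>i] by (rule borel_measurable_times[rotated])
    show "AE \<omega> in M. norm (\<xi> \<omega> $ i * Z \<omega> $ i) \<le> norm (B * (1 + (norm (Z \<omega>))\<^sup>2))"
    proof (rule AE_I2)
      fix \<omega>
      have "0 \<le> (norm (Z \<omega>) - 1 / 2)\<^sup>2" by simp
      then have "norm (Z \<omega>) \<le> 1 + (norm (Z \<omega>))\<^sup>2"
        by (simp add: power2_eq_square algebra_simps)
      then have "\<bar>Z \<omega> $ i\<bar> \<le> 1 + (norm (Z \<omega>))\<^sup>2" using component_le_norm_cart order_trans by blast
      moreover have "\<bar>\<xi> \<omega> $ i\<bar> \<le> B" using component_le_norm_cart \<xi>(2) order_trans by blast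
      ultimately have "\<bar>\<xi> \<omega> $ i\<bar> * \<bar>Z \<omega> $ i\<bar> \<le> B * (1 + (norm (Z \<omega>))\<^sup>2)"
        using B0 by (intro mult_mono) auto
      then show "norm (\<xi> \<omega> $ i * Z \<omega> $ i) \<le> norm (B * (1 + (norm (Z \<omega>))\<^sup>2))"
        using B0 by (simp add: abs_mult)
    qed
  qed
  have zero_i: "(\<integral>\<omega>. \<xi> \<omega> $ i * Z \<omega> $ i \<partial>M) = 0" for i
  proof -
    have "(\<integral>\<omega>. \<xi> \<omega> $ i * Z \<omega> $ i \<partial>M) = (\<integral>\<omega>. \<xi> \<omega> $ i * real_cond_exp M F (\<lambda>\<omega>. Z \<omega> $ i) \<omega> \<partial>M)"
      by (rule real_cond_exp_intg(2)[OF int \<xi>i Zi, symmetric])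
    also have "\<dots> = (\<integral>\<omega>. 0 \<partial>M)"
    proof (rule integral_cong_AE)
      show "AE \<omega> in M. \<xi> \<omega> $ i * real_cond_exp M F (\<lambda>\<omega>. Z \<omega> $ i) \<omega> = 0"
        using zero by eventually_elim (simp add: vec_cond_exp_def vec_eq_iff)
      show "(\<lambda>\<omega>. \<xi> \<omega> $ i * real_cond_exp M F (\<lambda>\<omega>. Z \<omega> $ i) \<omega>) \<in> borel_measurable M"
        using measurable_from_subalg[OF subalg \<xi>i] by (intro borel_measurable_times) auto
    qed simp
    finally show ?thesis by simp
  qed
  show "integrable M (\<lambda>\<omega>. \<xi> \<omega> \<bullet> Z \<omega>)" "(\<integral>\<omega>. \<xi> \<omega> \<bullet> Z \<omega> \<partial>M) = 0"
    using int zero_i by (simp_all add: inner_vec_def)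
qed

text \<open>Integrability is asked of the product of \<open>\<xi>\<close> and \<open>v\<close>: in
  the application \<open>v\<close> is \<open>f (y n)\<close>, which may fail to be integrable, while
  \<open>\<xi>\<close> vanishes unless \<open>y n\<close> lies in a sublevel set where
  \<open>f\<close> is bounded.\<close>

lemma (in finite_measure_subalgebra) cond_exp_bound_integral:
  fixes \<xi> q v :: "'a \<Rightarrow> real"
  assumes q: "integrable M q" and bound: "AE \<omega> in M. real_cond_exp M F q \<omega> \<le> v \<omega>"
    and \<xi>: "\<xi> \<in> borel_measurable F" "\<And>\<omega>. 0 \<le> \<xi> \<omega>" "\<And>\<omega>. \<xi> \<omega> \<le> B"
    and \<xi>v: "integrable M (\<lambda>\<omega>. \<xi> \<omega> * v \<omega>)"
  shows "integrable M (\<lambda>\<omega>. \<xi> \<omega> * q \<omega>)" "(\<integral>\<omega>. \<xi> \<omega> * q \<omega> \<partial>M) \<le> (\<integral>\<omega>. \<xi> \<omega> * v \<omega> \<partial>M)"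
proof -
  have \<xi>M: "\<xi> \<in> borel_measurable M" by (rule measurable_from_subalg[OF subalg \<xi>(1)])
  show int: "integrable M (\<lambda>\<omega>. \<xi> \<omega> * q \<omega>)"
  proof (rule Bochner_Integration.integrable_bound)
    show "integrable M (\<lambda>\<omega>. B * q \<omega>)" using q by auto
    show "AE \<omega> in M. norm (\<xi> \<omega> * q \<omega>) \<le> norm (B * q \<omega>)"
      using \<xi>(2) order_trans[OF \<xi>(3) abs_ge_self]
      by (intro AE_I2) (auto simp: abs_mult intro!: mult_right_mono)
  qed (use \<xi>M q in auto)
  have "(\<integral>\<omega>. \<xi> \<omega> * q \<omega> \<partial>M) = (\<integral>\<omega>. \<xi> \<omega> * real_cond_exp M F q \<omega> \<partial>M)"
    using real_cond_exp_intg(2)[OF int \<xi>(1)] q by simp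
  also have "\<dots> \<le> (\<integral>\<omega>. \<xi> \<omega> * v \<omega> \<partial>M)"
  proof (rule integral_mono_AE)
    show "integrable M (\<lambda>\<omega>. \<xi> \<omega> * real_cond_exp M F q \<omega>)"
      using real_cond_exp_intg(1)[OF int \<xi>(1)] q by simp
    show "AE \<omega> in M. \<xi> \<omega> * real_cond_exp M F q \<omega> \<le> \<xi> \<omega> * v \<omega>"
      using bound by eventually_elim (use \<xi>(2) in \<open>auto intro: mult_left_mono\<close>)
  qed (rule \<xi>v)
  finally show "(\<integral>\<omega>. \<xi> \<omega> * q \<omega> \<partial>M) \<le> (\<integral>\<omega>. \<xi> \<omega> * v \<omega> \<partial>M)" .
qed

section \<open>Recursions with adapted step sizes\<close>

lemma sets_history:
  "sets (history P Y Z n) = sigma_sets (space P)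
     (sets (vimage_algebra (space P) Y borel) \<union>
        (\<Union>i\<in>{1..n}. sets (vimage_algebra (space P) (Z i) borel)))"
proof -
  have "sets (vimage_algebra (space P) X borel) \<subseteq> Pow (space P)" for X :: "'a \<Rightarrow> 'b"
    using sets.space_closed[of "vimage_algebra (space P) X borel"] by simp
  then show ?thesis
    unfolding history_def by (intro sets_measure_of Un_least UN_least)
qed

lemma space_history: "space (history P Y Z n) = space P"
  by (simp add: history_def space_measure_of_conv)

lemma history_mono: "k \<le> l \<Longrightarrow> sets (history P Y Z k) \<subseteq> sets (history P Y Z l)"
  unfolding sets_history by (intro sigma_sets_mono' Un_mono UN_mono) auto

lemma measurable_history:
  "Y \<in> borel_measurable (history P Y Z n)"
  "1 \<le> i \<Longrightarrow> i \<le> n \<Longrightarrow> Z i \<in> borel_measurable (history P Y Z n)"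
proof -
  have *: "X \<in> borel_measurable (history P Y Z n)"
    if "sets (vimage_algebra (space P) X borel) \<subseteq> sets (history P Y Z n)" for X
    using that by (auto simp: measurable_def space_history in_vimage_algebra subset_iff)
  show "Y \<in> borel_measurable (history P Y Z n)"
    by (rule *) (auto simp: sets_history)
  show "Z i \<in> borel_measurable (history P Y Z n)" if "1 \<le> i" "i \<le> n"
    using that by (intro *) (auto simp: sets_history)
qed

text \<open>The hypotheses in the form in which they act: second derivatives enter through the
  Lipschitz constant \<open>L\<close>, and the choice of \<open>N\<close>, \<open>c_N\<close> and
  \<open>g\<close> through \<open>growth\<close>, \<open>g_ge_1\<close> and the regularity of
  \<open>g\<close>. Since the step is \<open>a n / g x\<close>, \<open>growth\<close> bounds the
  second order term relative to \<open>1 + W\<close>.\<close>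

locale adaptive_recursion = prob_space P
  for P :: "'w measure" +
  fixes h :: "real ^ 'd \<Rightarrow> real ^ 'd" and a :: "nat \<Rightarrow> real"
    and W f g :: "real ^ 'd \<Rightarrow> real" and y Z :: "nat \<Rightarrow> 'w \<Rightarrow> real ^ 'd"
    and m L C :: real
  assumes a_pos: "\<And>n. a n > 0"
    and a_sum: "filterlim (\<lambda>n. \<Sum>k<n. a k) at_top sequentially"
    and a_sq: "summable (\<lambda>n. (a n)\<^sup>2)"
    and h_cont: "continuous_on UNIV h"
    and W_diff: "\<And>x. W differentiable (at x)"
    and W_lip: "\<And>x z. norm (grad W x - grad W z) \<le> L * norm (x - z)"
    and L_nonneg: "L \<ge> 0"
    and W_nonneg: "\<And>x. W x \<ge> 0"
    and W_coercive: "filterlim W at_top at_infinity"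
    and m_nonneg: "m \<ge> 0"
    and drift: "\<And>x. W x \<ge> m \<Longrightarrow> h x \<bullet> grad W x < 0"
    and f_nonneg: "\<And>x. f x \<ge> 0"
    and f_meas: "f \<in> borel_measurable borel"
    and f_bounded: "locally_bounded f"
    and g_ge_1: "\<And>x. g x \<ge> 1"
    and g_meas: "g \<in> borel_measurable borel"
    and g_bounded: "locally_bounded g"
    and growth: "\<And>x. ((norm (h x))\<^sup>2 + f x) / (g x)\<^sup>2 \<le> C * (1 + W x)"
    and y0_meas: "y 0 \<in> borel_measurable P"
    and Z_meas: "\<And>n. n \<ge> 1 \<Longrightarrow> Z n \<in> borel_measurable P"
    and Z_sq: "\<And>n. n \<ge> 1 \<Longrightarrow> integrable P (\<lambda>\<omega>. (norm (Z n \<omega>))\<^sup>2)"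
    and Z_mean: "\<And>n. AE \<omega> in P. vec_cond_exp P (history P (y 0) Z n) (Z (Suc n)) \<omega> = 0"
    and Z_var: "\<And>n. AE \<omega> in P.
          real_cond_exp P (history P (y 0) Z n) (\<lambda>w. (norm (Z (Suc n) w))\<^sup>2) \<omega> \<le> f (y n \<omega>)"
    and iterates: "\<And>n \<omega>. \<omega> \<in> space P \<Longrightarrow>
          y (Suc n) \<omega> = y n \<omega> + (a n / g (y n \<omega>)) *\<^sub>R (h (y n \<omega>) + Z (Suc n) \<omega>)"
begin

abbreviation F :: "nat \<Rightarrow> 'w measure" where
  "F n \<equiv> history P (y 0) Z n"

abbreviation step :: "nat \<Rightarrow> real ^ 'd \<Rightarrow> real" where
  "step n x \<equiv> a n / g x"

abbreviation V :: "real ^ 'd \<Rightarrow> real" where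
  "V x \<equiv> huber (W x - m)"

lemma W_cont: "continuous_on A W"
  using W_diff by (intro differentiable_imp_continuous_on)
    (auto simp: differentiable_on_def differentiable_at_withinI)

lemma grad_cont: "continuous_on A (grad W)"
proof -
  have "L-lipschitz_on UNIV (grad W)"
    using W_lip L_nonneg by (intro lipschitz_onI) (auto simp: dist_norm)
  then show ?thesis using lipschitz_on_continuous_on continuous_on_subset by blast
qed

lemma W_compact: "compact {x. W x \<le> r}"
  by (rule compact_sublevel_coercive[OF W_cont W_coercive])

lemma cont_bounded:
  fixes \<phi> :: "real ^ 'd \<Rightarrow> 'b::real_normed_vector"
  assumes "continuous_on UNIV \<phi>"
  obtains B where "B \<ge> 0" "\<And>x. W x \<le> r \<Longrightarrow> norm (\<phi> x) \<le> B"
proof -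
  have "bounded (\<phi> ` {x. W x \<le> r})"
    by (intro compact_imp_bounded compact_continuous_image W_compact continuous_on_subset[OF assms]) auto
  then obtain B where "B > 0" "\<forall>x\<in>\<phi> ` {x. W x \<le> r}. norm x \<le> B"
    unfolding bounded_pos by blast
  then show thesis using that[of B] by auto
qed

lemma W_meas[measurable]: "W \<in> borel_measurable borel"
  by (rule borel_measurable_continuous_onI[OF W_cont])

lemma grad_meas[measurable]: "grad W \<in> borel_measurable borel"
  by (rule borel_measurable_continuous_onI[OF grad_cont])

lemma h_meas[measurable]: "h \<in> borel_measurable borel"
  by (rule borel_measurable_continuous_onI[OF h_cont])

lemma huber_meas[measurable]: "huber \<in> borel_measurable borel"
  using huber_mono by (intro borel_measurable_mono) (auto simp: mono_def)

lemma huber'_meas[measurable]: "huber' \<in> borel_measurable borel"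
  by (rule borel_measurable_continuous_onI[OF continuous_huber'])

declare f_meas[measurable] g_meas[measurable]

lemma F_subalgebra: "subalgebra P (F n)"
  using y0_meas Z_meas by (rule subalgebra_history)

lemma F_finite: "finite_measure_subalgebra P (F n)"
  unfolding finite_measure_subalgebra_def finite_measure_subalgebra_axioms_def
  using F_subalgebra finite_measure_axioms by blast

lemma measurable_F_mono:
  "\<xi> \<in> borel_measurable (F k) \<Longrightarrow> k \<le> l \<Longrightarrow> \<xi> \<in> borel_measurable (F l)"
  using history_mono[of k l P "y 0" Z] by (auto simp: measurable_def space_history)

lemma y_F: "y n \<in> borel_measurable (F n)"
proof (induction n)
  case 0
  show ?case by (rule measurable_history)
next
  case (Suc n)
  have [measurable]: "y n \<in> borel_measurable (F (Suc n))"
    using Suc by (rule measurable_F_mono) simp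
  have [measurable]: "Z (Suc n) \<in> borel_measurable (F (Suc n))"
    by (rule measurable_history) auto
  have "(\<lambda>\<omega>. y n \<omega> + step n (y n \<omega>) *\<^sub>R (h (y n \<omega>) + Z (Suc n) \<omega>)) \<in> borel_measurable (F (Suc n))"
    by measurable
  moreover have "y (Suc n) \<in> borel_measurable (F (Suc n)) \<longleftrightarrow>
      (\<lambda>\<omega>. y n \<omega> + step n (y n \<omega>) *\<^sub>R (h (y n \<omega>) + Z (Suc n) \<omega>)) \<in> borel_measurable (F (Suc n))"
    by (rule measurable_cong) (use iterates in \<open>simp add: space_history\<close>)
  ultimately show ?case by simp
qed

lemma y_meas[measurable]: "y n \<in> borel_measurable P"
  by (rule measurable_from_subalg[OF F_subalgebra y_F])

lemma step_pos: "step n x > 0" and step_le: "step n x \<le> a n"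
proof -
  show "step n x > 0" using a_pos[of n] g_ge_1[of x] by simp
  show "step n x \<le> a n"
    using a_pos[of n] g_ge_1[of x] mult_left_mono[of 1 "g x" "a n"] by (simp add: divide_le_eq)
qed

lemma integrable_on_sublevel:
  fixes \<phi> :: "real ^ 'd \<Rightarrow> real"
  assumes A: "A \<in> sets P" "\<And>\<omega>. \<omega> \<in> A \<Longrightarrow> W (y n \<omega>) \<le> r"
    and \<phi>[measurable]: "\<phi> \<in> borel_measurable borel" and B: "\<And>x. W x \<le> r \<Longrightarrow> \<bar>\<phi> x\<bar> \<le> B"
  shows "integrable P (\<lambda>\<omega>. indicator A \<omega> * \<phi> (y n \<omega>))"
proof (rule integrable_const_bound)
  show "AE \<omega> in P. norm (indicator A \<omega> * \<phi> (y n \<omega>)) \<le> \<bar>B\<bar>"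
    using A(2) B by (intro AE_I2) (auto split: split_indicator intro: order_trans[OF _ abs_ge_self])
  show "(\<lambda>\<omega>. indicator A \<omega> * \<phi> (y n \<omega>)) \<in> borel_measurable P"
    using A(1) by measurable
qed

text \<open>The drift term is nonpositive everywhere, since \<open>V\<close> has zero gradient on \<open>{W \<le> m}\<close>.\<close>
lemma V_step:
  obtains c where "c \<ge> 0" and
    "\<And>n x z. V (x + step n x *\<^sub>R (h x + z)) \<le> V x
        + (step n x * huber' (W x - m)) *\<^sub>R grad W x \<bullet> z + (2 * c * (step n x)\<^sup>2) *\<^sub>R h x \<bullet> z
        + c * (step n x)\<^sup>2 * ((norm (h x))\<^sup>2 + (norm z)\<^sup>2)"
proof -
  obtain G where G: "G \<ge> 0" "\<And>x. W x \<le> m + 1 \<Longrightarrow> norm (grad W x) \<le> G"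
    using cont_bounded[OF grad_cont] by metis
  define c where "c = (G + L)\<^sup>2 + G + 2 * L"
  show thesis
  proof
    show "c \<ge> 0" using G(1) L_nonneg by (simp add: c_def)
    fix n x z
    let ?u = "step n x *\<^sub>R (h x + z)"
    let ?q = "huber' (W x - m)"
    have "V (x + ?u) \<le> V x + ?q * (grad W x \<bullet> ?u) + c * (norm ?u)\<^sup>2"
      unfolding c_def using W_diff W_lip G(2) L_nonneg G(1) by (rule huber_comp_remainder)
    moreover have "?q * (grad W x \<bullet> h x) \<le> 0"
      using drift[of x] huber'_range[of "W x - m"] huber'_eq_0[of "W x - m"]
      by (cases "W x \<ge> m") (auto simp: inner_commute mult_nonneg_nonpos)
    then have "step n x * (?q * (grad W x \<bullet> h x)) \<le> 0"
      by (rule mult_nonneg_nonpos[OF less_imp_le[OF step_pos]])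
    \<comment> \<open>The cross term is kept rather than estimated: it is linear in
      \<open>z\<close>, so like the gradient term it disappears on integration.\<close>
    moreover have "(norm ?u)\<^sup>2 = (step n x)\<^sup>2 * ((norm (h x))\<^sup>2 + 2 * (h x \<bullet> z) + (norm z)\<^sup>2)"
      by (simp only: norm_scaleR power_mult_distrib power2_abs)
        (simp add: power2_norm_eq_inner inner_add_left inner_add_right inner_commute)
    ultimately show "V (x + ?u) \<le> V x
        + (step n x * ?q) *\<^sub>R grad W x \<bullet> z + (2 * c * (step n x)\<^sup>2) *\<^sub>R h x \<bullet> z
        + c * (step n x)\<^sup>2 * ((norm (h x))\<^sup>2 + (norm z)\<^sup>2)"
      by (simp add: inner_add_right distrib_left mult_ac)
  qed
qed

text \<open>The terms linear in the noise integrate to zero and the rest is at most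
  \<open>c * (a n)\<^sup>2 * (V x + 1)\<close> at \<open>x = y n \<omega>\<close>, which the extra
  factor in the denominator absorbs. The level \<open>r\<close> only secures integrability, and
  \<open>c\<close> does not depend on it; \<open>p\<close> is arbitrary so that it can be the
  running product of earlier factors.\<close>

lemma expected_V_step:
  obtains c where "c \<ge> 0" and
    "\<And>n r p A. A \<in> sets (F n) \<Longrightarrow> (\<And>\<omega>. \<omega> \<in> A \<Longrightarrow> W (y n \<omega>) \<le> r) \<Longrightarrow> p > 0 \<Longrightarrow>
      (\<integral>\<^sup>+\<omega>. ennreal ((V (y (Suc n) \<omega>) + 1) / (p * (1 + c * (a n)\<^sup>2))) * indicator A \<omega> \<partial>P)
      \<le> (\<integral>\<^sup>+\<omega>. ennreal ((V (y n \<omega>) + 1) / p) * indicator A \<omega> \<partial>P)"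
proof -
  obtain k where k: "k \<ge> 0" and Vs: "\<And>n x z. V (x + step n x *\<^sub>R (h x + z)) \<le> V x
        + (step n x * huber' (W x - m)) *\<^sub>R grad W x \<bullet> z + (2 * k * (step n x)\<^sup>2) *\<^sub>R h x \<bullet> z
        + k * (step n x)\<^sup>2 * ((norm (h x))\<^sup>2 + (norm z)\<^sup>2)"
    by (rule V_step) blast
  \<comment> \<open>\<open>k\<close> is the second order constant for \<open>V\<close>,
    \<open>\<bar>C\<bar>\<close> comes from \<open>growth\<close>, and \<open>m + 2\<close> from
    \<open>1 + W x \<le> V x + m + 2 \<le> (m + 2) * (V x + 1)\<close>.\<close>
  define c where "c = k * \<bar>C\<bar> * (m + 2)"
  have c: "c \<ge> 0" using k m_nonneg by (simp add: c_def)
  show thesis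
  proof (rule that[OF c])
    fix n r p A
    assume AF: "A \<in> sets (F n)" and Ar: "\<And>\<omega>. \<omega> \<in> A \<Longrightarrow> W (y n \<omega>) \<le> r" and p: "p > (0::real)"
    interpret Fn: finite_measure_subalgebra P "F n" by (rule F_finite)
    have AM[measurable]: "A \<in> sets P" using AF F_subalgebra[of n] by (auto simp: subalgebra_def)
    have AF'[measurable]: "A \<in> sets (F n)" by (rule AF)
    have yF[measurable]: "y n \<in> borel_measurable (F n)" by (rule y_F)
    obtain H where H: "H \<ge> 0" "\<And>x. W x \<le> r \<Longrightarrow> norm (h x) \<le> H"
      using cont_bounded[OF h_cont] by metis
    obtain G where G: "G \<ge> 0" "\<And>x. W x \<le> r \<Longrightarrow> norm (grad W x) \<le> G"
      using cont_bounded[OF grad_cont] by metis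
    obtain B where B: "\<And>x. W x \<le> r \<Longrightarrow> \<bar>f x\<bar> \<le> B"
      using locally_bounded_compact[OF f_bounded W_compact] by (metis mem_Collect_eq)
    have st2: "(step n x)\<^sup>2 \<le> (a n)\<^sup>2" for x
      using step_le step_pos[of n x] by (intro power_mono) (auto simp: less_imp_le)
    define \<kappa> where "\<kappa> x = k * (step n x)\<^sup>2" for x
    have \<kappa>[measurable]: "\<kappa> \<in> borel_measurable borel" unfolding \<kappa>_def[abs_def] by measurable
    have \<kappa>_nonneg: "0 \<le> \<kappa> x" and \<kappa>_le: "\<kappa> x \<le> k * (a n)\<^sup>2" for x
      using k st2[of x] by (auto simp: \<kappa>_def intro: mult_left_mono)
    \<comment> \<open>Everything paired with the noise, collected into one vector field, so that a
      single orthogonality statement removes both linear terms.\<close>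
    define \<theta> where "\<theta> x = (step n x * huber' (W x - m)) *\<^sub>R grad W x + (2 * \<kappa> x) *\<^sub>R h x" for x
    have \<theta>[measurable]: "\<theta> \<in> borel_measurable borel" unfolding \<theta>_def[abs_def] by measurable
    have \<theta>_le: "norm (\<theta> x) \<le> a n * G + 2 * (k * (a n)\<^sup>2) * H" if "W x \<le> r" for x
    proof -
      have "step n x * huber' (W x - m) \<le> a n * 1"
        using step_le step_pos[of n x] huber'_range[of "W x - m"] a_pos[of n]
        by (intro mult_mono) (auto simp: less_imp_le)
      then have "norm ((step n x * huber' (W x - m)) *\<^sub>R grad W x) \<le> a n * G"
        using G(2)[OF that] a_pos[of n]
          abs_of_nonneg[OF mult_nonneg_nonneg[OF less_imp_le[OF step_pos] huber'_range(1)], of n x "W x - m"]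
        unfolding norm_scaleR by (intro mult_mono) auto
      moreover have "norm ((2 * \<kappa> x) *\<^sub>R h x) \<le> 2 * (k * (a n)\<^sup>2) * H"
        using mult_mono[OF \<kappa>_le[of x] H(2)[OF that]] \<kappa>_nonneg[of x] \<kappa>_le[of x] by (simp add: abs_mult)
      ultimately show ?thesis unfolding \<theta>_def by (rule norm_triangle_le[OF add_mono])
    qed
    have V_le: "V x \<le> \<bar>r\<bar>" if "W x \<le> r" for x
      using huber_le[of "W x - m"] that m_nonneg by auto
    let ?I = "\<lambda>\<omega>. indicator A \<omega> :: real"
    let ?q = "\<lambda>\<omega>. (norm (Z (Suc n) \<omega>))\<^sup>2"
    have I1: "integrable P (\<lambda>\<omega>. ?I \<omega> * (V (y n \<omega>) + 1))"
      by (rule integrable_on_sublevel[where r = r and B = "\<bar>r\<bar> + 1" and \<phi> = "\<lambda>x. V x + 1"])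
        (use Ar V_le huber_nonneg in \<open>auto simp: add_nonneg_nonneg\<close>)
    have \<xi>F: "(\<lambda>\<omega>. ?I \<omega> *\<^sub>R \<theta> (y n \<omega>)) \<in> borel_measurable (F n)" by measurable
    have bnd: "0 \<le> a n * G + 2 * (k * (a n)\<^sup>2) * H"
      using a_pos[of n] G(1) H(1) k by (simp add: less_imp_le)
    have "norm (?I \<omega> *\<^sub>R \<theta> (y n \<omega>)) \<le> a n * G + 2 * (k * (a n)\<^sup>2) * H" for \<omega>
      using \<theta>_le[OF Ar, of \<omega>] bnd by (auto split: split_indicator)
    note I2 = Fn.vec_cond_exp_orthogonal[OF Z_meas Z_sq Z_mean \<xi>F this]
    have \<kappa>h: "norm (\<kappa> x * (norm (h x))\<^sup>2) \<le> k * (a n)\<^sup>2 * H\<^sup>2" if "W x \<le> r" for x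
      using H(2)[OF that] \<kappa>_nonneg[of x] \<kappa>_le[of x] k
      by (simp add: abs_mult) (intro mult_mono power_mono, auto)
    have I3: "integrable P (\<lambda>\<omega>. ?I \<omega> * (\<kappa> (y n \<omega>) * (norm (h (y n \<omega>)))\<^sup>2))"
      by (rule integrable_on_sublevel[where r = r and \<phi> = "\<lambda>x. \<kappa> x * (norm (h x))\<^sup>2"])
        (use Ar \<kappa>h in auto)
    have \<kappa>f: "\<bar>\<kappa> x * f x\<bar> \<le> k * (a n)\<^sup>2 * B" if "W x \<le> r" for x
      using B[OF that] \<kappa>_nonneg[of x] \<kappa>_le[of x] k f_nonneg[of x]
      by (simp add: abs_mult) (intro mult_mono, auto)
    have I4: "integrable P (\<lambda>\<omega>. ?I \<omega> * (\<kappa> (y n \<omega>) * f (y n \<omega>)))"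
      by (rule integrable_on_sublevel[where r = r and \<phi> = "\<lambda>x. \<kappa> x * f x"]) (use Ar \<kappa>f in auto)
    have \<kappa>F: "(\<lambda>\<omega>. ?I \<omega> * \<kappa> (y n \<omega>)) \<in> borel_measurable (F n)" by measurable
    have I4': "integrable P (\<lambda>\<omega>. (?I \<omega> * \<kappa> (y n \<omega>)) * f (y n \<omega>))"
      using I4 by (simp add: mult.assoc)
    have "0 \<le> ?I \<omega> * \<kappa> (y n \<omega>)" "?I \<omega> * \<kappa> (y n \<omega>) \<le> k * (a n)\<^sup>2" for \<omega>
      using \<kappa>_nonneg[of "y n \<omega>"] \<kappa>_le[of "y n \<omega>"] k by (auto split: split_indicator)
    note I5 = Fn.cond_exp_bound_integral[OF Z_sq Z_var \<kappa>F this I4']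
    define J where "J \<omega> = ?I \<omega> * (V (y n \<omega>) + 1) + ?I \<omega> *\<^sub>R \<theta> (y n \<omega>) \<bullet> Z (Suc n) \<omega>
        + ?I \<omega> * (\<kappa> (y n \<omega>) * (norm (h (y n \<omega>)))\<^sup>2) + (?I \<omega> * \<kappa> (y n \<omega>)) * ?q \<omega>" for \<omega>
    have J: "integrable P J"
      unfolding J_def[abs_def] using I1 I2(1) I3 I5(1) by simp
    have VJ: "?I \<omega> * (V (y (Suc n) \<omega>) + 1) \<le> J \<omega>" if "\<omega> \<in> space P" for \<omega>
      using Vs[of "y n \<omega>" n "Z (Suc n) \<omega>"] iterates[OF that]
      by (auto simp: J_def \<theta>_def \<kappa>_def inner_add_left distrib_left mult_ac split: split_indicator)
    have J_nonneg: "0 \<le> J \<omega>" if "\<omega> \<in> space P" for \<omega>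
      by (rule order_trans[OF _ VJ[OF that]]) (simp add: huber_nonneg add_nonneg_nonneg)
    let ?w = "1 + c * (a n)\<^sup>2"
    have w: "?w > 0" using c by (intro add_pos_nonneg) auto
    \<comment> \<open>Here the adapted step size acts: \<open>(step n x)\<^sup>2\<close> carries the
      factor \<open>1 / (g x)\<^sup>2\<close> that \<open>growth\<close> requires.\<close>
    have cV: "\<kappa> x * ((norm (h x))\<^sup>2 + f x) \<le> c * (a n)\<^sup>2 * (V x + 1)" for x
    proof -
      have "\<kappa> x * ((norm (h x))\<^sup>2 + f x) = k * (a n)\<^sup>2 * (((norm (h x))\<^sup>2 + f x) / (g x)\<^sup>2)"
        by (simp add: \<kappa>_def power_divide)
      also have "\<dots> \<le> k * (a n)\<^sup>2 * (\<bar>C\<bar> * ((m + 2) * (V x + 1)))"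
      proof (intro mult_left_mono order_trans[OF growth])
        have "1 + W x \<le> (m + 2) * (V x + 1)"
        proof -
          have "(m + 2) * (V x + 1) = m * V x + 2 * V x + m + 2" by (simp add: algebra_simps)
          then show ?thesis
            using huber_ge[of "W x - m"] huber_nonneg[of "W x - m"]
              mult_nonneg_nonneg[OF m_nonneg huber_nonneg, of "W x - m"] by linarith
        qed
        then show "C * (1 + W x) \<le> \<bar>C\<bar> * ((m + 2) * (V x + 1))"
          using W_nonneg[of x] by (intro mult_mono) auto
      qed (use k in auto)
      finally show ?thesis by (simp add: c_def mult_ac)
    qed
    have "(\<integral>\<omega>. J \<omega> \<partial>P) = (\<integral>\<omega>. ?I \<omega> * (V (y n \<omega>) + 1) \<partial>P)
        + (\<integral>\<omega>. ?I \<omega> * (\<kappa> (y n \<omega>) * (norm (h (y n \<omega>)))\<^sup>2) \<partial>P) + (\<integral>\<omega>. (?I \<omega> * \<kappa> (y n \<omega>)) * ?q \<omega> \<partial>P)"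
      unfolding J_def[abs_def] using I1 I2 I3 I5(1) by simp
    also have "\<dots> \<le> (\<integral>\<omega>. ?I \<omega> * (V (y n \<omega>) + 1) \<partial>P)
        + (\<integral>\<omega>. ?I \<omega> * (\<kappa> (y n \<omega>) * (norm (h (y n \<omega>)))\<^sup>2) \<partial>P) + (\<integral>\<omega>. (?I \<omega> * \<kappa> (y n \<omega>)) * f (y n \<omega>) \<partial>P)"
      using I5(2) by simp
    also have "\<dots> = (\<integral>\<omega>. ?I \<omega> * (V (y n \<omega>) + 1) + ?I \<omega> * (\<kappa> (y n \<omega>) * (norm (h (y n \<omega>)))\<^sup>2)
        + (?I \<omega> * \<kappa> (y n \<omega>)) * f (y n \<omega>) \<partial>P)"
      using I1 I3 I4' by simp
    also have "\<dots> \<le> (\<integral>\<omega>. ?w * (?I \<omega> * (V (y n \<omega>) + 1)) \<partial>P)"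
    proof (rule integral_mono)
      show "integrable P (\<lambda>\<omega>. ?I \<omega> * (V (y n \<omega>) + 1) + ?I \<omega> * (\<kappa> (y n \<omega>) * (norm (h (y n \<omega>)))\<^sup>2)
        + (?I \<omega> * \<kappa> (y n \<omega>)) * f (y n \<omega>))"
        using I1 I3 I4' by simp
      show "integrable P (\<lambda>\<omega>. ?w * (?I \<omega> * (V (y n \<omega>) + 1)))" using I1 by simp
      show "?I \<omega> * (V (y n \<omega>) + 1) + ?I \<omega> * (\<kappa> (y n \<omega>) * (norm (h (y n \<omega>)))\<^sup>2)
        + (?I \<omega> * \<kappa> (y n \<omega>)) * f (y n \<omega>) \<le> ?w * (?I \<omega> * (V (y n \<omega>) + 1))" for \<omega>
        using cV[of "y n \<omega>"] by (auto simp: algebra_simps split: split_indicator)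
    qed
    also have "\<dots> = ?w * (\<integral>\<omega>. ?I \<omega> * (V (y n \<omega>) + 1) \<partial>P)" by simp
    finally have JI: "(\<integral>\<omega>. J \<omega> \<partial>P) \<le> ?w * (\<integral>\<omega>. ?I \<omega> * (V (y n \<omega>) + 1) \<partial>P)" .
    have "(\<integral>\<^sup>+\<omega>. ennreal ((V (y (Suc n) \<omega>) + 1) / (p * ?w)) * indicator A \<omega> \<partial>P)
        \<le> (\<integral>\<^sup>+\<omega>. ennreal (J \<omega> / (p * ?w)) \<partial>P)"
    proof (rule nn_integral_mono)
      fix \<omega> assume \<omega>: "\<omega> \<in> space P"
      have "?I \<omega> * (V (y (Suc n) \<omega>) + 1) / (p * ?w) \<le> J \<omega> / (p * ?w)"
        using VJ[OF \<omega>] p w by (intro divide_right_mono) auto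
      then show "ennreal ((V (y (Suc n) \<omega>) + 1) / (p * ?w)) * indicator A \<omega> \<le> ennreal (J \<omega> / (p * ?w))"
        by (auto split: split_indicator intro: ennreal_leI)
    qed
    also have "\<dots> = ennreal (\<integral>\<omega>. J \<omega> / (p * ?w) \<partial>P)"
      using J J_nonneg p w by (intro nn_integral_eq_integral AE_I2 divide_nonneg_pos) auto
    also have "\<dots> \<le> ennreal (\<integral>\<omega>. ?I \<omega> * (V (y n \<omega>) + 1) / p \<partial>P)"
      using JI p w by (intro ennreal_leI) (simp add: divide_le_eq mult_ac)
    also have "\<dots> = (\<integral>\<^sup>+\<omega>. ennreal (?I \<omega> * (V (y n \<omega>) + 1) / p) \<partial>P)"
      using I1 p huber_nonneg
      by (intro nn_integral_eq_integral[symmetric] AE_I2) (auto intro!: divide_nonneg_pos mult_nonneg_nonneg add_nonneg_nonneg)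
    also have "\<dots> = (\<integral>\<^sup>+\<omega>. ennreal ((V (y n \<omega>) + 1) / p) * indicator A \<omega> \<partial>P)"
      by (intro nn_integral_cong) (auto split: split_indicator)
    finally show "(\<integral>\<^sup>+\<omega>. ennreal ((V (y (Suc n) \<omega>) + 1) / (p * ?w)) * indicator A \<omega> \<partial>P)
      \<le> (\<integral>\<^sup>+\<omega>. ennreal ((V (y n \<omega>) + 1) / p) * indicator A \<omega> \<partial>P)" .
  qed
qed

text \<open>Since \<open>y 0\<close> may lack moments, the process is first multiplied by the
  indicator of \<open>norm (y 0 \<omega>) \<le> real R\<close>, an event known at time 0 on which
  \<open>V (y 0 \<omega>)\<close> is bounded. Every path belongs to such an event for some natural
  \<open>R\<close>, and only countably many null sets are discarded.\<close>

lemma AE_W_bounded: "AE \<omega> in P. \<exists>R::nat. \<forall>n. W (y n \<omega>) \<le> real R"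
proof -
  obtain c where c: "c \<ge> 0" and Es:
    "\<And>n r p A. A \<in> sets (F n) \<Longrightarrow> (\<And>\<omega>. \<omega> \<in> A \<Longrightarrow> W (y n \<omega>) \<le> r) \<Longrightarrow> p > 0 \<Longrightarrow>
      (\<integral>\<^sup>+\<omega>. ennreal ((V (y (Suc n) \<omega>) + 1) / (p * (1 + c * (a n)\<^sup>2))) * indicator A \<omega> \<partial>P)
      \<le> (\<integral>\<^sup>+\<omega>. ennreal ((V (y n \<omega>) + 1) / p) * indicator A \<omega> \<partial>P)"
    by (rule expected_V_step) blast
  define p where "p n = (\<Prod>j<n. 1 + c * (a j)\<^sup>2)" for n
  have p_pos: "p n > 0" for n unfolding p_def using c by (intro prod_pos) (simp add: add_pos_nonneg)
  have p_Suc: "p (Suc n) = p n * (1 + c * (a n)\<^sup>2)" for n by (simp add: p_def)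
  \<comment> \<open>By \<open>1 + t \<le> exp t\<close> this bounds all the products, because the
    squares of the steps are summable; a bound on the quotient therefore passes to \<open>V\<close>
    with a fixed factor.\<close>
  define q where "q = exp (c * (\<Sum>j. (a j)\<^sup>2))"
  have p_le: "p n \<le> q" for n
  proof -
    have "p n \<le> (\<Prod>j<n. exp (c * (a j)\<^sup>2))"
      unfolding p_def using c by (intro prod_mono) (auto simp: add_nonneg_nonneg)
    also have "\<dots> = exp (c * (\<Sum>j<n. (a j)\<^sup>2))" by (simp add: exp_sum sum_distrib_left)
    also have "\<dots> \<le> q"
      unfolding q_def using c by (simp add: mult_left_mono sum_le_suminf[OF a_sq])
    finally show ?thesis .
  qed
  have "AE \<omega> in P. \<exists>r::nat. \<forall>n. indicator {\<omega>. norm (y 0 \<omega>) \<le> real R} \<omega> * ennreal ((V (y n \<omega>) + 1) / p n) < ennreal (real r)"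
    for R :: nat
  proof (rule AE_bounded_supermartingale)
    let ?X = "\<lambda>n \<omega>. indicator {\<omega>. norm (y 0 \<omega>) \<le> real R} \<omega> * ennreal ((V (y n \<omega>) + 1) / p n)"
    have XF: "?X n \<in> borel_measurable (F n)" for n
    proof -
      have [measurable]: "y 0 \<in> borel_measurable (F n)" "y n \<in> borel_measurable (F n)"
        using y_F measurable_F_mono[OF y_F, of 0 n] by auto
      show ?thesis by measurable
    qed
    show "?X n \<in> borel_measurable P" for n by (rule measurable_from_subalg[OF F_subalgebra XF])
    show "(\<integral>\<^sup>+\<omega>. ?X 0 \<omega> \<partial>P) < \<infinity>"
    proof -
      have "bounded (W ` cball 0 (real R))"
        by (intro compact_imp_bounded compact_continuous_image W_cont compact_cball)
      then obtain b where "\<forall>x\<in>cball 0 (real R). \<bar>W x\<bar> \<le> b"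
        unfolding bounded_iff by auto
      then have b: "\<And>x. norm x \<le> real R \<Longrightarrow> \<bar>W x\<bar> \<le> b" by simp
      have "(\<integral>\<^sup>+\<omega>. ?X 0 \<omega> \<partial>P) \<le> (\<integral>\<^sup>+\<omega>. ennreal (\<bar>b\<bar> + 1) \<partial>P)"
      proof (rule nn_integral_mono)
        fix \<omega>
        have "V (y 0 \<omega>) + 1 \<le> \<bar>b\<bar> + 1" if "norm (y 0 \<omega>) \<le> real R"
          using huber_le[of "W (y 0 \<omega>) - m"] b[OF that] m_nonneg by auto
        then show "?X 0 \<omega> \<le> ennreal (\<bar>b\<bar> + 1)"
          by (auto simp: p_def simp del: ennreal_plus split: split_indicator intro!: ennreal_leI)
      qed
      also have "\<dots> < \<infinity>" by (simp add: emeasure_space_1)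
      finally show ?thesis .
    qed
    fix l :: real and n
    let ?B = "{\<omega> \<in> space P. \<forall>j\<le>n. ?X j \<omega> < ennreal l}"
    let ?A = "?B \<inter> {\<omega> \<in> space P. norm (y 0 \<omega>) \<le> real R}"
    have B: "?B \<in> sets (F n)"
    proof -
      have "?B = (\<Inter>j\<in>{..n}. {\<omega> \<in> space (F n). ?X j \<omega> < ennreal l})"
        by (auto simp: space_history)
      also have "\<dots> \<in> sets (F n)"
      proof (intro sets.finite_INT)
        fix j assume "j \<in> {..n}"
        then have [measurable]: "y 0 \<in> borel_measurable (F n)" "y j \<in> borel_measurable (F n)"
          using measurable_F_mono[OF y_F, of 0 n] measurable_F_mono[OF y_F, of j n] by auto
        show "{\<omega> \<in> space (F n). ?X j \<omega> < ennreal l} \<in> sets (F n)" by measurable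
      qed auto
      finally show ?thesis .
    qed
    have A: "?A \<in> sets (F n)"
    proof -
      have [measurable]: "y 0 \<in> borel_measurable (F n)" by (rule measurable_F_mono[OF y_F]) simp
      have "{\<omega> \<in> space (F n). norm (y 0 \<omega>) \<le> real R} \<in> sets (F n)" by measurable
      then show ?thesis using B unfolding space_history by (rule sets.Int[rotated])
    qed
    \<comment> \<open>Not having reached level \<open>l\<close> means
      \<open>V (y n \<omega>) + 1 < l * p n\<close>, which by \<open>huber_ge\<close> confines
      \<open>y n \<omega>\<close> to a sublevel set of \<open>W\<close>; this is the localisation
      that \<open>expected_V_step\<close> asks for.\<close>
    have Ar: "W (y n \<omega>) \<le> l * p n + m" if "\<omega> \<in> ?A" for \<omega>
    proof -
      from that have "?X n \<omega> < ennreal l" and "norm (y 0 \<omega>) \<le> real R" by blast+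
      then have "ennreal ((V (y n \<omega>) + 1) / p n) < ennreal l" by simp
      then have "(V (y n \<omega>) + 1) / p n < l"
        using p_pos[of n] huber_nonneg[of "W (y n \<omega>) - m"] by (simp add: ennreal_less_iff)
      then have "V (y n \<omega>) + 1 < l * p n" using p_pos[of n] by (simp add: divide_less_eq)
      then show ?thesis using huber_ge[of "W (y n \<omega>) - m"] by linarith
    qed
    have "(\<integral>\<^sup>+\<omega>. ?X (Suc n) \<omega> * indicator ?B \<omega> \<partial>P)
        = (\<integral>\<^sup>+\<omega>. ennreal ((V (y (Suc n) \<omega>) + 1) / (p n * (1 + c * (a n)\<^sup>2))) * indicator ?A \<omega> \<partial>P)"
      by (intro nn_integral_cong) (auto simp: p_Suc split: split_indicator)
    also have "\<dots> \<le> (\<integral>\<^sup>+\<omega>. ennreal ((V (y n \<omega>) + 1) / p n) * indicator ?A \<omega> \<partial>P)"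
      by (rule Es[OF A Ar p_pos])
    also have "\<dots> = (\<integral>\<^sup>+\<omega>. ?X n \<omega> * indicator ?B \<omega> \<partial>P)"
      by (intro nn_integral_cong) (auto split: split_indicator)
    finally show "(\<integral>\<^sup>+\<omega>. ?X (Suc n) \<omega> * indicator ?B \<omega> \<partial>P) \<le> (\<integral>\<^sup>+\<omega>. ?X n \<omega> * indicator ?B \<omega> \<partial>P)" .
  qed
  then have "AE \<omega> in P. \<forall>R::nat. \<exists>r::nat. \<forall>n. indicator {\<omega>. norm (y 0 \<omega>) \<le> real R} \<omega> * ennreal ((V (y n \<omega>) + 1) / p n) < ennreal (real r)"
    by (subst AE_all_countable) auto
  then show ?thesis
  proof eventually_elim
    case (elim \<omega>)
    obtain R :: nat where R: "norm (y 0 \<omega>) \<le> real R" using real_arch_simple by blast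
    obtain r :: nat where r: "\<And>n. ennreal ((V (y n \<omega>) + 1) / p n) < ennreal (real r)"
      using elim[rule_format, of R] R by auto
    obtain R' :: nat where R': "real r * q + m \<le> real R'" using real_arch_simple by blast
    have "W (y n \<omega>) \<le> real R'" for n
    proof -
      have "(V (y n \<omega>) + 1) / p n < real r"
        using r[of n] p_pos[of n] huber_nonneg[of "W (y n \<omega>) - m"] by (simp add: ennreal_less_iff)
      then have "V (y n \<omega>) + 1 < real r * p n" using p_pos[of n] by (simp add: divide_less_eq)
      also have "\<dots> \<le> real r * q" using p_le by (intro mult_left_mono) auto
      finally show ?thesis using huber_ge[of "W (y n \<omega>) - m"] R' by linarith
    qed
    then show ?case by blast
  qed
qed

text \<open>Truncation replaces a stopping time: the truncated factor is known at time
  \<open>n\<close>, so orthogonality survives, and \<open>f\<close> is bounded wherever the factor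
  is nonzero. On a path with \<open>W \<le> R\<close> throughout, nothing is truncated.\<close>

lemma AE_noise_summable:
  "AE \<omega> in P. summable (\<lambda>n. (if W (y n \<omega>) \<le> R then step n (y n \<omega>) else 0) *\<^sub>R Z (Suc n) \<omega>)"
proof -
  obtain B where B: "\<And>x. W x \<le> R \<Longrightarrow> \<bar>f x\<bar> \<le> B"
    using locally_bounded_compact[OF f_bounded W_compact] by (metis mem_Collect_eq)
  let ?s = "\<lambda>n x. if W x \<le> R then step n x else 0"
  have s: "0 \<le> ?s n x" "?s n x \<le> a n" for n x
    using step_pos[of n x] step_le[of n x] a_pos[of n] by auto
  have s_meas[measurable]: "?s n \<in> borel_measurable borel" for n by measurable
  show ?thesis
  proof (rule martingale_differences_summable[where F = F and b = "\<lambda>n. (a n)\<^sup>2 * \<bar>B\<bar>"])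
    show "subalgebra P (F k)" for k by (rule F_subalgebra)
    show "sets (F k) \<subseteq> sets (F l)" if "k \<le> l" for k l using that by (rule history_mono)
    show "(\<lambda>\<omega>. ?s k (y k \<omega>) *\<^sub>R Z (Suc k) \<omega>) \<in> borel_measurable (F (Suc k))" for k
    proof -
      have [measurable]: "y k \<in> borel_measurable (F (Suc k))"
        by (rule measurable_F_mono[OF y_F]) simp
      have [measurable]: "Z (Suc k) \<in> borel_measurable (F (Suc k))"
        by (rule measurable_history) auto
      show ?thesis by measurable
    qed
    show "(\<integral>\<omega>. \<xi> \<omega> \<bullet> ?s k (y k \<omega>) *\<^sub>R Z (Suc k) \<omega> \<partial>P) = 0"
      if \<xi>[measurable]: "\<xi> \<in> borel_measurable (F k)" and b: "\<And>\<omega>. norm (\<xi> \<omega>) \<le> b" for k \<xi> b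
    proof -
      interpret Fk: finite_measure_subalgebra P "F k" by (rule F_finite)
      have [measurable]: "y k \<in> borel_measurable (F k)" by (rule y_F)
      have \<xi>': "(\<lambda>\<omega>. ?s k (y k \<omega>) *\<^sub>R \<xi> \<omega>) \<in> borel_measurable (F k)" by measurable
      have "norm (?s k (y k \<omega>) *\<^sub>R \<xi> \<omega>) \<le> a k * b" for \<omega>
        using mult_mono[OF s(2)[of "y k \<omega>" k] b[of \<omega>]] s(1)[of "y k \<omega>" k] a_pos[of k]
        unfolding norm_scaleR abs_of_nonneg[OF s(1)] by simp
      from Fk.vec_cond_exp_orthogonal(2)[OF Z_meas Z_sq Z_mean \<xi>' this]
      show ?thesis by simp
    qed
    have sq: "integrable P (\<lambda>\<omega>. (norm (?s k (y k \<omega>) *\<^sub>R Z (Suc k) \<omega>))\<^sup>2) \<and>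
        (\<integral>\<omega>. (norm (?s k (y k \<omega>) *\<^sub>R Z (Suc k) \<omega>))\<^sup>2 \<partial>P) \<le> (a k)\<^sup>2 * \<bar>B\<bar>" for k
    proof -
      interpret Fk: finite_measure_subalgebra P "F k" by (rule F_finite)
      have [measurable]: "y k \<in> borel_measurable (F k)" by (rule y_F)
      have \<kappa>: "(\<lambda>\<omega>. (?s k (y k \<omega>))\<^sup>2) \<in> borel_measurable (F k)" by measurable
      have \<kappa>_le: "(?s k x)\<^sup>2 \<le> (a k)\<^sup>2" for x using s by (rule power_mono[rotated])
      have \<kappa>f: "0 \<le> (?s k x)\<^sup>2 * f x" "(?s k x)\<^sup>2 * f x \<le> (a k)\<^sup>2 * \<bar>B\<bar>" for x
      proof -
        show "0 \<le> (?s k x)\<^sup>2 * f x" using f_nonneg by simp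
        show "(?s k x)\<^sup>2 * f x \<le> (a k)\<^sup>2 * \<bar>B\<bar>"
        proof (cases "W x \<le> R")
          case True
          then have "f x \<le> \<bar>B\<bar>" using B[OF True] by linarith
          then show ?thesis using \<kappa>_le[of x] f_nonneg[of x] by (intro mult_mono) auto
        qed simp
      qed
      have int: "integrable P (\<lambda>\<omega>. (?s k (y k \<omega>))\<^sup>2 * f (y k \<omega>))"
      proof (rule integrable_const_bound)
        show "AE \<omega> in P. norm ((?s k (y k \<omega>))\<^sup>2 * f (y k \<omega>)) \<le> (a k)\<^sup>2 * \<bar>B\<bar>"
          unfolding real_norm_def abs_of_nonneg[OF \<kappa>f(1)] using \<kappa>f(2) by (intro AE_I2)
      qed measurable
      note * = Fk.cond_exp_bound_integral[OF Z_sq Z_var \<kappa> zero_le_power2 \<kappa>_le int]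
      have "(\<integral>\<omega>. (?s k (y k \<omega>))\<^sup>2 * f (y k \<omega>) \<partial>P) \<le> (\<integral>\<omega>. (a k)\<^sup>2 * \<bar>B\<bar> \<partial>P)"
        using int \<kappa>f(2) by (intro integral_mono) auto
      then show ?thesis
        using * unfolding norm_scaleR power_mult_distrib power2_abs by (simp add: prob_space)
    qed
    show "integrable P (\<lambda>\<omega>. (norm (?s k (y k \<omega>) *\<^sub>R Z (Suc k) \<omega>))\<^sup>2)" for k using sq by blast
    show "(\<integral>\<omega>. (norm (?s k (y k \<omega>) *\<^sub>R Z (Suc k) \<omega>))\<^sup>2 \<partial>P) \<le> (a k)\<^sup>2 * \<bar>B\<bar>" for k using sq by blast
    show "summable (\<lambda>n. (a n)\<^sup>2 * \<bar>B\<bar>)" using a_sq by (rule summable_mult2)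
  qed
qed

text \<open>The bound on \<open>W\<close> along a path is random. Restricting it to naturals leaves
  countably many truncated noise series, so almost surely all of them converge and the one matching
  the path can be chosen; the rest is deterministic.\<close>

lemma AE_converges:
  "AE \<omega> in P. (\<lambda>n. infdist (y n \<omega>) (closure {x. W x < m})) \<longlonglongrightarrow> 0 \<and> bounded (range (\<lambda>n. y n \<omega>))"
proof -
  have "AE \<omega> in P. \<forall>R::nat. summable (\<lambda>n. (if W (y n \<omega>) \<le> real R then step n (y n \<omega>) else 0) *\<^sub>R Z (Suc n) \<omega>)"
    by (subst AE_all_countable) (intro allI AE_noise_summable)
  with AE_W_bounded AE_space show ?thesis
  proof eventually_elim
    case (elim \<omega>)
    then obtain R :: nat where R: "\<And>n. W (y n \<omega>) \<le> real R" by blast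
    have noise: "summable (\<lambda>n. step n (y n \<omega>) *\<^sub>R Z (Suc n) \<omega>)"
      using elim(3)[rule_format, of R] R by simp
    have a0: "a \<longlonglongrightarrow> 0"
      using tendsto_real_sqrt[OF summable_LIMSEQ_zero[OF a_sq]] a_pos by (simp add: less_imp_le)
    have s0: "(\<lambda>n. step n (y n \<omega>)) \<longlonglongrightarrow> 0"
    proof (rule tendsto_sandwich[OF always_eventually always_eventually tendsto_const])
      show "\<forall>n. 0 \<le> step n (y n \<omega>)" using less_imp_le[OF step_pos] by simp
      show "\<forall>n. step n (y n \<omega>) \<le> a n" using step_le by simp
    qed (rule a0)
    \<comment> \<open>On the compact sublevel set \<open>g\<close> is at most \<open>G\<close>, so
      the adapted steps are at least \<open>a k / G\<close> and their sum still diverges.\<close>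
    obtain G where G: "\<And>x. W x \<le> real R \<Longrightarrow> \<bar>g x\<bar> \<le> G"
      using locally_bounded_compact[OF g_bounded W_compact] by (metis mem_Collect_eq)
    have G1: "G \<ge> 1" using G[OF R[of 0]] g_ge_1[of "y 0 \<omega>"] by linarith
    have s_inf: "filterlim (\<lambda>n. \<Sum>k<n. step k (y k \<omega>)) at_top sequentially"
    proof (rule filterlim_at_top_mono)
      show "filterlim (\<lambda>n. (1 / G) * (\<Sum>k<n. a k)) at_top sequentially"
        using G1 by (intro filterlim_tendsto_pos_mult_at_top[OF tendsto_const _ a_sum]) auto
      show "eventually (\<lambda>n. (1 / G) * (\<Sum>k<n. a k) \<le> (\<Sum>k<n. step k (y k \<omega>))) sequentially"
      proof (intro always_eventually allI)
        fix n
        have "a k / G \<le> step k (y k \<omega>)" for k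
          using G[OF R[of k]] g_ge_1[of "y k \<omega>"] a_pos[of k] by (intro divide_left_mono) auto
        then have "(\<Sum>k<n. a k / G) \<le> (\<Sum>k<n. step k (y k \<omega>))" by (intro sum_mono)
        then show "(1 / G) * (\<Sum>k<n. a k) \<le> (\<Sum>k<n. step k (y k \<omega>))"
          by (simp add: sum_divide_distrib)
      qed
    qed
    have "(\<lambda>n. infdist (y n \<omega>) (closure {x. W x < m})) \<longlonglongrightarrow> 0"
    proof (rule perturbed_descent_converges[OF W_diff W_lip L_nonneg W_nonneg W_coercive h_cont drift
          step_pos s0 s_inf noise R])
      show "y (Suc n) \<omega> = y n \<omega> + step n (y n \<omega>) *\<^sub>R h (y n \<omega>) + step n (y n \<omega>) *\<^sub>R Z (Suc n) \<omega>" for n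
        using iterates[OF elim(2)] by (simp add: scaleR_add_right)
    qed
    moreover have "bounded (range (\<lambda>n. y n \<omega>))"
      by (rule bounded_subset[OF compact_imp_bounded[OF W_compact[of "real R"]]]) (use R in auto)
    ultimately show ?case by blast
  qed
qed

end

text \<open>Above level \<open>N\<close> the square root in the lower bound for \<open>g\<close> is
  made to turn the quotient into at most \<open>W x\<close>. Up to a finite \<open>N\<close> the
  numerator is bounded by compactness. For infinite \<open>N\<close> compactness serves below
  \<open>M\<close>, and \<open>c_N\<close> gives linear growth in \<open>W\<close> from there on. In
  these last cases dividing by \<open>(g x)\<^sup>2 \<ge> 1\<close> only helps.\<close>

lemma growth_of_adapted_steps:
  fixes h :: "real ^ 'd \<Rightarrow> real ^ 'd" and W f g :: "real ^ 'd \<Rightarrow> real" and M :: nat and N :: enat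
  assumes W: "continuous_on UNIV W" "filterlim W at_top at_infinity" "\<And>x. W x \<ge> 0"
    and h: "continuous_on UNIV h" and f: "\<And>x. f x \<ge> 0" "locally_bounded f" and M: "M > 0"
    and c_N: "\<exists>c::real. ereal c > max 1
          (SUP x \<in> closure (sublevel W (ereal_of_enat N)) - sublevel W (ereal (real M)).
             ereal (((norm (h x))\<^sup>2 + f x) / W x))"
    and g_ge: "\<And>x. g x \<ge> max 1
          (if ereal (W x) > ereal_of_enat N then sqrt (((norm (h x))\<^sup>2 + f x) / W x) else 0)"
  obtains C where "\<And>x. ((norm (h x))\<^sup>2 + f x) / (g x)\<^sup>2 \<le> C * (1 + W x)"
proof -
  define q where "q x = (norm (h x))\<^sup>2 + f x" for x
  have q0: "q x \<ge> 0" for x using f(1)[of x] by (simp add: q_def)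
  have g1: "g x \<ge> 1" for x using g_ge[of x] by simp
  have g2: "q x / (g x)\<^sup>2 \<le> q x" for x
    using q0[of x] mult_left_mono[OF one_le_power[OF g1, of x 2] q0[of x]] g1[of x]
    by (simp add: divide_le_eq)
  have compact_bound: "\<exists>B. \<forall>x. W x \<le> r \<longrightarrow> q x \<le> B" for r
  proof -
    have "compact {x. W x \<le> r}" using W(1,2) by (rule compact_sublevel_coercive)
    then obtain B where B: "\<And>x. W x \<le> r \<Longrightarrow> \<bar>f x\<bar> \<le> B"
      using locally_bounded_compact[OF f(2)] by (metis mem_Collect_eq)
    have "bounded (h ` {x. W x \<le> r})"
      by (intro compact_imp_bounded compact_continuous_image continuous_on_subset[OF h]
          \<open>compact {x. W x \<le> r}\<close>) auto
    then obtain H where H: "\<And>x. W x \<le> r \<Longrightarrow> norm (h x) \<le> H"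
      unfolding bounded_iff by auto
    have "q x \<le> H\<^sup>2 + B" if "W x \<le> r" for x
      unfolding q_def using B[OF that] power_mono[OF H[OF that], of 2] by auto
    then show ?thesis by blast
  qed
  \<comment> \<open>\<open>C \<ge> 1\<close> is requested so that the same constant covers the
    region above \<open>N\<close>, where the bound is \<open>W x\<close> itself.\<close>
  have "\<exists>C\<ge>1. \<forall>x. \<not> ereal (W x) > ereal_of_enat N \<longrightarrow> q x \<le> C * (1 + W x)"
  proof (cases N)
    case (enat n)
    obtain B where B: "\<And>x. W x \<le> real n \<Longrightarrow> q x \<le> B" using compact_bound by blast
    have "q x \<le> (\<bar>B\<bar> + 1) * (1 + W x)" if "\<not> ereal (W x) > ereal_of_enat N" for x
    proof -
      have "q x \<le> B" using that by (intro B) (simp add: enat)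
      also have "B \<le> (\<bar>B\<bar> + 1) * 1" by simp
      also have "\<dots> \<le> (\<bar>B\<bar> + 1) * (1 + W x)" using W(3)[of x] by (intro mult_left_mono) auto
      finally show ?thesis .
    qed
    then show ?thesis by (intro exI[of _ "\<bar>B\<bar> + 1"]) auto
  next
    case infinity
    obtain B where B: "\<And>x. W x \<le> real M \<Longrightarrow> q x \<le> B" using compact_bound by blast
    obtain c :: real where c: "ereal c > max 1
          (SUP x \<in> closure (sublevel W (ereal_of_enat N)) - sublevel W (ereal (real M)).
             ereal (q x / W x))"
      using c_N unfolding q_def by blast
    have "q x \<le> (\<bar>B\<bar> + \<bar>c\<bar> + 1) * (1 + W x)" for x
    proof (cases "W x < real M")
      case True
      then have "q x \<le> B" by (intro B) simp
      also have "B \<le> (\<bar>B\<bar> + \<bar>c\<bar> + 1) * 1" by simp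
      also have "\<dots> \<le> (\<bar>B\<bar> + \<bar>c\<bar> + 1) * (1 + W x)" using W(3)[of x] by (intro mult_left_mono) auto
      finally show ?thesis .
    next
      case False
      have "sublevel W (ereal_of_enat N) = UNIV" by (simp add: sublevel_def infinity)
      then have "x \<in> closure (sublevel W (ereal_of_enat N)) - sublevel W (ereal (real M))"
        using False by (simp add: sublevel_def)
      then have "ereal (q x / W x) \<le> (SUP x \<in> closure (sublevel W (ereal_of_enat N)) - sublevel W (ereal (real M)).
             ereal (q x / W x))"
        by (rule SUP_upper)
      also have "\<dots> < ereal c" using c by simp
      \<comment> \<open>Multiplying out is legitimate because \<open>W x \<ge> real M > 0\<close>
        here.\<close>
      finally have "q x \<le> c * W x" using False M by (simp add: divide_less_eq)
      also have "\<dots> \<le> (\<bar>B\<bar> + \<bar>c\<bar> + 1) * (1 + W x)" using W(3)[of x] by (intro mult_mono) auto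
      finally show ?thesis .
    qed
    then show ?thesis by (intro exI[of _ "\<bar>B\<bar> + \<bar>c\<bar> + 1"]) auto
  qed
  then obtain C where C: "C \<ge> 1" "\<And>x. \<not> ereal (W x) > ereal_of_enat N \<Longrightarrow> q x \<le> C * (1 + W x)"
    by blast
  have "q x / (g x)\<^sup>2 \<le> C * (1 + W x)" for x
  proof (cases "ereal (W x) > ereal_of_enat N")
    case True
    \<comment> \<open>This excludes division by 0 in \<open>g_ge\<close>, whose default value 0
      would carry no information.\<close>
    have Wx: "W x > 0"
    proof -
      have "ereal_of_enat N \<ge> 0" by simp
      with True have "ereal (W x) > 0" by (rule le_less_trans[rotated])
      then show ?thesis by simp
    qed
    have "sqrt (q x / W x) \<le> g x" using g_ge[of x] True by (simp add: q_def)
    then have "(sqrt (q x / W x))\<^sup>2 \<le> (g x)\<^sup>2" using q0[of x] Wx by (intro power_mono) auto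
    then have "q x / W x \<le> (g x)\<^sup>2" using q0[of x] Wx by simp
    moreover have "(g x)\<^sup>2 > 0" using g1[of x] by simp
    ultimately have "q x / (g x)\<^sup>2 \<le> W x" using Wx by (simp add: divide_le_eq mult.commute)
    also have "\<dots> \<le> C * (1 + W x)" using C(1) Wx mult_mono[of 1 C "W x" "1 + W x"] by simp
    finally show ?thesis .
  next
    case False
    then show ?thesis using C(2) g2[of x] order_trans by blast
  qed
  then show thesis using that unfolding q_def by blast
qed

theorem theorem12:
  fixes P :: "'w measure"
    and h :: "real ^ 'd \<Rightarrow> real ^ 'd"
    and a :: "nat \<Rightarrow> real"
    and W f g :: "real ^ 'd \<Rightarrow> real"
    and y Z :: "nat \<Rightarrow> 'w \<Rightarrow> real ^ 'd"
    and M :: nat and N :: enat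
  assumes P: "prob_space P"
    and a_pos: "\<And>n. a n > 0"
    and W_C1: "C1 W"
    and y0_meas: "y 0 \<in> borel_measurable P"
    and Z_meas: "\<And>n. n \<ge> 1 \<Longrightarrow> Z n \<in> borel_measurable P"
    and A1: "local_lipschitz (UNIV :: real set) UNIV (\<lambda>_. h)"
    and A2i: "filterlim (\<lambda>n. \<Sum>k<n. a k) at_top sequentially"
    and A2ii: "summable (\<lambda>n. (a n)\<^sup>2)"
    and A3i: "\<And>n. AE \<omega> in P. vec_cond_exp P (history P (y 0) Z n) (Z (Suc n)) \<omega> = 0"
    and A3ii_square_integrable: "\<And>n. n \<ge> 1 \<Longrightarrow> integrable P (\<lambda>\<omega>. (norm (Z n \<omega>))\<^sup>2)"
    and A3ii_f: "\<And>x. f x \<ge> 0" "f \<in> borel_measurable borel" "locally_bounded f"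
    and A3ii_bound: "\<And>n. AE \<omega> in P.
          real_cond_exp P (history P (y 0) Z n) (\<lambda>w. (norm (Z (Suc n) w))\<^sup>2) \<omega> \<le> f (y n \<omega>)"
    and A4i: "\<And>x. W x \<ge> 0" "filterlim W at_top at_infinity"
    and A4ii: "M > 0" "\<And>x. W x \<ge> real M \<Longrightarrow> h x \<bullet> grad W x < 0"
    and A5: "C2 W" "\<exists>K. \<forall>i j x. \<bar>pderiv2 W i j x\<bar> \<le> K"
    and N: "enat M < N"
    and c_N: "\<exists>c::real. ereal c > max 1
          (SUP x \<in> closure (sublevel W (ereal_of_enat N)) - sublevel W (ereal (real M)).
             ereal (((norm (h x))\<^sup>2 + f x) / W x))"
    and g: "g \<in> borel_measurable borel" "locally_bounded g"
    and g_ge: "\<And>x. g x \<ge> max 1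
          (if ereal (W x) > ereal_of_enat N then sqrt (((norm (h x))\<^sup>2 + f x) / W x) else 0)"
    and iterates: "\<And>n \<omega>. \<omega> \<in> space P \<Longrightarrow>
          y (Suc n) \<omega> = y n \<omega> + (a n / g (y n \<omega>)) *\<^sub>R (h (y n \<omega>) + Z (Suc n) \<omega>)"
  shows "(AE \<omega> in P.
            (\<lambda>n. infdist (y n \<omega>) (closure (sublevel W (ereal (real M))))) \<longlonglongrightarrow> 0)
       \<and> (AE \<omega> in P. (SUP n. ereal (norm (y n \<omega>))) < \<infinity>)"
proof -
  interpret prob_space P by (rule P)
  have W_diff: "W differentiable (at x)" for x using W_C1 by (simp add: C1_def)
  then have W_cont: "continuous_on UNIV W"
    by (intro differentiable_imp_continuous_on) (auto simp: differentiable_on_def)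
  have h_cont: "continuous_on UNIV h"
    using local_lipschitz_continuous_on[OF A1, of 0] by simp
  have g_ge_1: "g x \<ge> 1" for x using g_ge[of x] by simp
  obtain K where "\<And>i j x. \<bar>pderiv2 W i j x\<bar> \<le> K" using A5(2) by blast
  with A5(1) obtain L where L: "L > 0" "\<And>x z. norm (grad W x - grad W z) \<le> L * norm (x - z)"
    by (rule C2_lipschitz_grad) (rule that)
  obtain C where C: "\<And>x. ((norm (h x))\<^sup>2 + f x) / (g x)\<^sup>2 \<le> C * (1 + W x)"
    using growth_of_adapted_steps[OF W_cont A4i(2,1) h_cont A3ii_f(1,3) A4ii(1) c_N g_ge] by blast
  interpret adaptive_recursion P h a W f g y Z "real M" L C
    by unfold_locales (fact a_pos A2i A2ii h_cont W_diff L(2) less_imp_le[OF L(1)] A4i of_nat_0_le_iff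
      A4ii(2) A3ii_f g_ge_1 g C y0_meas Z_meas A3ii_square_integrable A3i A3ii_bound iterates)+
  have "sublevel W (ereal (real M)) = {x. W x < real M}" by (simp add: sublevel_def)
  moreover have "(SUP n. ereal (norm (y n \<omega>))) < \<infinity>" if bd: "bounded (range (\<lambda>n. y n \<omega>))" for \<omega>
  proof -
    obtain B where "\<And>n. norm (y n \<omega>) \<le> B" using bd unfolding bounded_iff by auto
    then have "(SUP n. ereal (norm (y n \<omega>))) \<le> ereal B" by (intro SUP_least) simp
    then show ?thesis using le_less_trans by force
  qed
  ultimately show ?thesis
    using AE_converges by (auto elim: eventually_mono)
qed

end
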